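(* Let $\mathcal{X}\subseteq\mathbb{R}^n$ and let $\mathcal{D}$ be a distribution on $\mathcal{X}\times[0,1]$ with marginal $\mathcal{D}_{\mathcal{X}}$ on $\mathcal{X}$, such that $\mathbb{E}[y\mid\mathbf{x}]=u(f(\mathbf{x}))$ where $u:\mathbb{R}\to[0,1]$ is a known $L$-Lipschitz non-decreasing function and $f$ is $(\epsilon,B,M)$-approximated over $\mathcal{D}_{\mathcal{X}}$ by some kernel function $\mathcal{K}$ with $\mathcal{K}(\mathbf{x},\mathbf{x}')\le 1$. Then for $\delta\in(0,1)$, there exists an algorithm that draws $m$ i.i.d. samples from $\mathcal{D}$ and outputs a hypothesis $h$ such that with probability $1-\delta$, $\varepsilon(h)\le O(L\epsilon)$, for $m=O\left(\left(\frac{LM}{\epsilon}\right)^4+\left(\frac{BL}{\epsilon}\right)^2\right)\cdot\log(1/\delta)$, in time $\mathrm{poly}(n,B,M,L,1/\epsilon,\log(1/\delta))$.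
   Context: Kernels are assumed computable in time polynomial in the input dimension $n$. Definition: let $f:\mathcal{X}\to\mathbb{R}$, $\mathcal{D}$ a distribution over $\mathcal{X}$, and $\mathcal{K}$ a kernel with RKHS $\mathcal{H}$ and feature map $\psi$; $f$ is $(\epsilon,B,M)$-approximated by $\mathcal{K}$ over $\mathcal{D}$ if there is $\mathbf{v}\in\mathcal{H}$ with $\|\mathbf{v}\|\le B$ such that $|f(\mathbf{x})-\langle\mathbf{v},\psi(\mathbf{x})\rangle|\le M$ for all $\mathbf{x}\in\mathcal{X}$ and $\mathbb{E}_{\mathbf{x}\sim\mathcal{D}}[(f(\mathbf{x})-\langle\mathbf{v},\psi(\mathbf{x})\rangle)^2]\le\epsilon^2$. For a hypothesis $h$, $\varepsilon(h)=\mathbb{E}_{(\mathbf{x},y)\sim\mathcal{D}}[(h(\mathbf{x})-\mathbb{E}[y\mid\mathbf{x}])^2]$.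
   Formalization: In the bound on m, L is replaced by max(1,L) and log(1/δ) by max(1, log(1/δ)), since with a universal constant the printed bound fails for small L (rescale u and f) and for δ near 1 (it would force m = 0). *)

theory Defs
  imports "HOL-Probability.Probability" "HOL-Library.Landau_Symbols"
begin

section \<open>Kernels, approximation and risk\<close>

text \<open>
  The dimension \<open>n\<close> has to vary inside one statement, because running times are measured in
  \<open>n\<close> for one fixed program.  Hence points of \<open>n\<close>-space are functions in \<open>extensional {..<n}\<close>.
\<close>

type_synonym point = "nat \<Rightarrow> real"
type_synonym example = "point \<times> real"

definition points :: "nat \<Rightarrow> point measure" where
  "points n = Pi\<^sub>M {..<n} (\<lambda>_. borel)"

definition domain_space :: "nat \<Rightarrow> point set \<Rightarrow> point measure" where
  "domain_space n X = restrict_space (points n) X"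

definition example_space :: "nat \<Rightarrow> point set \<Rightarrow> example measure" where
  "example_space n X = domain_space n X \<Otimes>\<^sub>M restrict_space borel {0..1}"

text \<open>
  The reproducing kernel Hilbert space of \<open>K\<close> on \<open>X\<close>: a Hilbert space \<open>H\<close> (with inner product
  \<open>ip\<close>) of functions on \<open>X\<close> that contains the functions \<open>K(x, -)\<close> and in which they reproduce
  point evaluation.  The feature map is \<open>x \<mapsto> K(x, -)\<close>.  Symmetry and positive semidefiniteness
  of \<open>K\<close> on \<open>X\<close> are consequences.
\<close>

definition feature :: "point set \<Rightarrow> (point \<Rightarrow> point \<Rightarrow> real) \<Rightarrow> point \<Rightarrow> (point \<Rightarrow> real)" where
  "feature X K x = (\<lambda>x'\<in>X. K x x')"

definition lin_comb :: "point set \<Rightarrow> real \<Rightarrow> (point \<Rightarrow> real) \<Rightarrow> real \<Rightarrow> (point \<Rightarrow> real) \<Rightarrow> (point \<Rightarrow> real)"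
  where "lin_comb X a g b h = (\<lambda>x\<in>X. a * g x + b * h x)"

locale rkhs =
  fixes X :: "point set"
    and K :: "point \<Rightarrow> point \<Rightarrow> real"
    and H :: "(point \<Rightarrow> real) set"
    and ip :: "(point \<Rightarrow> real) \<Rightarrow> (point \<Rightarrow> real) \<Rightarrow> real"
  assumes subset_extensional: "H \<subseteq> extensional X"
    and zero_mem: "(\<lambda>x\<in>X. 0) \<in> H"
    and lin_comb_mem: "\<And>g h a b. g \<in> H \<Longrightarrow> h \<in> H \<Longrightarrow> lin_comb X a g b h \<in> H"
    and ip_lin_comb: "\<And>g h k a b. g \<in> H \<Longrightarrow> h \<in> H \<Longrightarrow> k \<in> H \<Longrightarrow>
          ip (lin_comb X a g b h) k = a * ip g k + b * ip h k"
    and ip_commute: "\<And>g h. g \<in> H \<Longrightarrow> h \<in> H \<Longrightarrow> ip g h = ip h g"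
    and ip_nonneg: "\<And>g. g \<in> H \<Longrightarrow> 0 \<le> ip g g"
    and ip_definite: "\<And>g. g \<in> H \<Longrightarrow> ip g g = 0 \<Longrightarrow> g = (\<lambda>x\<in>X. 0)"
    and complete: "Metric_space.mcomplete H
          (\<lambda>g h. sqrt (ip (lin_comb X 1 g (- 1) h) (lin_comb X 1 g (- 1) h)))"
    and feature_mem: "\<And>x. x \<in> X \<Longrightarrow> feature X K x \<in> H"
    and reproducing: "\<And>g x. g \<in> H \<Longrightarrow> x \<in> X \<Longrightarrow> ip g (feature X K x) = g x"

text \<open>
  Measurability of the residual is required explicitly because the Bochner integral of a
  non-measurable function is \<open>0\<close>.
\<close>

definition kernel_approximated ::
  "point measure \<Rightarrow> (point \<Rightarrow> point \<Rightarrow> real) \<Rightarrow> (point \<Rightarrow> real) set \<Rightarrow>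
    ((point \<Rightarrow> real) \<Rightarrow> (point \<Rightarrow> real) \<Rightarrow> real) \<Rightarrow> (point \<Rightarrow> real) \<Rightarrow> real \<Rightarrow> real \<Rightarrow> real \<Rightarrow> bool"
  where
  "kernel_approximated DX K H ip f \<epsilon> B M \<longleftrightarrow>
    (\<exists>v\<in>H. sqrt (ip v v) \<le> B \<and>
      (\<forall>x\<in>space DX. \<bar>f x - ip v (feature (space DX) K x)\<bar> \<le> M) \<and>
      (\<lambda>x. f x - ip v (feature (space DX) K x)) \<in> borel_measurable DX \<and>
      (\<integral>x. (f x - ip v (feature (space DX) K x))\<^sup>2 \<partial>DX) \<le> \<epsilon>\<^sup>2)"

definition cond_mean :: "nat \<Rightarrow> point set \<Rightarrow> example measure \<Rightarrow> example \<Rightarrow> real" where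
  "cond_mean n X D = real_cond_exp D (vimage_algebra (space D) fst (domain_space n X)) snd"

definition risk :: "nat \<Rightarrow> point set \<Rightarrow> example measure \<Rightarrow> (point \<Rightarrow> real) \<Rightarrow> real" where
  "risk n X D h = (\<integral>z. (h (fst z) - cond_mean n X D z)\<^sup>2 \<partial>D)"


section \<open>Real-arithmetic random access machines\<close>

text \<open>
  Programs over two kinds of data: index registers holding natural numbers (addition and
  truncated subtraction only), and real registers together with an indirectly addressed memory
  of reals (exact field arithmetic, integer constants, \<open>x / 0 = 0\<close>).  There is no rounding and no
  other conversion from reals to natural numbers than by branching on comparisons.  Each node of
  an expression or condition costs one unit.
\<close>

datatype nexp = NConst nat | NReg nat | NPlus nexp nexp | NMinus nexp nexp

datatype rexp = RConst int | RReg nat | RMem nexp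
  | RPlus rexp rexp | RMinus rexp rexp | RTimes rexp rexp | RDivide rexp rexp

datatype bexp = NLess nexp nexp | RLess rexp rexp | Neg bexp | Conj bexp bexp

datatype com =
    Skip
  | NAssign nat nexp
  | RAssign nat rexp
  | Store nexp rexp
  | DrawExample nexp
  | CallKernel nat nexp nexp
  | CallLink nat rexp
  | Seq com com
  | Cond bexp com com
  | While bexp com

record state =
  nreg :: "nat \<Rightarrow> nat"
  rreg :: "nat \<Rightarrow> real"
  mem :: "nat \<Rightarrow> real"
  drawn :: nat

text \<open>
  What a program has access to besides its memory: the kernel (at cost \<open>kernel_cost\<close> per
  evaluation), the link function \<open>u\<close>, and the sequence of examples, read one after the other.
\<close>

record environment =
  dimension :: nat
  kernel :: "point \<Rightarrow> point \<Rightarrow> real"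
  kernel_cost :: nat
  link :: "real \<Rightarrow> real"
  examples :: "nat \<Rightarrow> example"

definition read_point :: "nat \<Rightarrow> nat \<Rightarrow> (nat \<Rightarrow> real) \<Rightarrow> point" where
  "read_point n a \<mu> = (\<lambda>i\<in>{..<n}. \<mu> (a + i))"

definition write_point :: "nat \<Rightarrow> nat \<Rightarrow> point \<Rightarrow> (nat \<Rightarrow> real) \<Rightarrow> (nat \<Rightarrow> real)" where
  "write_point n a x \<mu> = (\<lambda>j. if a \<le> j \<and> j < a + n then x (j - a) else \<mu> j)"

primrec nval :: "nexp \<Rightarrow> state \<Rightarrow> nat" where
  "nval (NConst k) s = k"
| "nval (NReg i) s = nreg s i"
| "nval (NPlus a b) s = nval a s + nval b s"
| "nval (NMinus a b) s = nval a s - nval b s"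

primrec ncost :: "nexp \<Rightarrow> nat" where
  "ncost (NConst k) = 1"
| "ncost (NReg i) = 1"
| "ncost (NPlus a b) = 1 + ncost a + ncost b"
| "ncost (NMinus a b) = 1 + ncost a + ncost b"

primrec rval :: "rexp \<Rightarrow> state \<Rightarrow> real" where
  "rval (RConst k) s = of_int k"
| "rval (RReg i) s = rreg s i"
| "rval (RMem a) s = mem s (nval a s)"
| "rval (RPlus p q) s = rval p s + rval q s"
| "rval (RMinus p q) s = rval p s - rval q s"
| "rval (RTimes p q) s = rval p s * rval q s"
| "rval (RDivide p q) s = rval p s / rval q s"

primrec rcost :: "rexp \<Rightarrow> nat" where
  "rcost (RConst k) = 1"
| "rcost (RReg i) = 1"
| "rcost (RMem a) = 1 + ncost a"
| "rcost (RPlus p q) = 1 + rcost p + rcost q"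
| "rcost (RMinus p q) = 1 + rcost p + rcost q"
| "rcost (RTimes p q) = 1 + rcost p + rcost q"
| "rcost (RDivide p q) = 1 + rcost p + rcost q"

primrec bval :: "bexp \<Rightarrow> state \<Rightarrow> bool" where
  "bval (NLess a b) s \<longleftrightarrow> nval a s < nval b s"
| "bval (RLess p q) s \<longleftrightarrow> rval p s < rval q s"
| "bval (Neg b) s \<longleftrightarrow> \<not> bval b s"
| "bval (Conj b c) s \<longleftrightarrow> bval b s \<and> bval c s"

primrec bcost :: "bexp \<Rightarrow> nat" where
  "bcost (NLess a b) = 1 + ncost a + ncost b"
| "bcost (RLess p q) = 1 + rcost p + rcost q"
| "bcost (Neg b) = 1 + bcost b"
| "bcost (Conj b c) = 1 + bcost b + bcost c"

text \<open>
  \<open>exec E c s t s'\<close>: in environment \<open>E\<close> the program \<open>c\<close>, started in \<open>s\<close>, stops after \<open>t\<close> time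
  units in \<open>s'\<close>.  A drawn example \<open>(x, y)\<close> occupies \<open>n + 1\<close> consecutive cells, the label last.
\<close>

inductive exec :: "environment \<Rightarrow> com \<Rightarrow> state \<Rightarrow> nat \<Rightarrow> state \<Rightarrow> bool" for E where
  Skip: "exec E Skip s 1 s"
| NAssign: "exec E (NAssign i a) s (1 + ncost a) (s\<lparr>nreg := (nreg s)(i := nval a s)\<rparr>)"
| RAssign: "exec E (RAssign i p) s (1 + rcost p) (s\<lparr>rreg := (rreg s)(i := rval p s)\<rparr>)"
| Store: "exec E (Store a p) s (1 + ncost a + rcost p)
            (s\<lparr>mem := (mem s)(nval a s := rval p s)\<rparr>)"
| DrawExample: "examples E (drawn s) = (x, y) \<Longrightarrow>
            exec E (DrawExample a) s (2 + ncost a + dimension E)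
              (s\<lparr>mem := (write_point (dimension E) (nval a s) x (mem s))(nval a s + dimension E := y),
                 drawn := drawn s + 1\<rparr>)"
| CallKernel: "exec E (CallKernel i a b) s (1 + ncost a + ncost b + kernel_cost E)
            (s\<lparr>rreg := (rreg s)(i := kernel E (read_point (dimension E) (nval a s) (mem s))
                                              (read_point (dimension E) (nval b s) (mem s)))\<rparr>)"
| CallLink: "exec E (CallLink i p) s (1 + rcost p)
            (s\<lparr>rreg := (rreg s)(i := link E (rval p s))\<rparr>)"
| Seq: "exec E c s t s' \<Longrightarrow> exec E d s' t' s'' \<Longrightarrow> exec E (Seq c d) s (t + t') s''"
| CondTrue: "bval b s \<Longrightarrow> exec E c s t s' \<Longrightarrow> exec E (Cond b c d) s (bcost b + t) s'"
| CondFalse: "\<not> bval b s \<Longrightarrow> exec E d s t s' \<Longrightarrow> exec E (Cond b c d) s (bcost b + t) s'"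
| WhileFalse: "\<not> bval b s \<Longrightarrow> exec E (While b c) s (bcost b) s"
| WhileTrue: "bval b s \<Longrightarrow> exec E c s t s' \<Longrightarrow> exec E (While b c) s' t' s'' \<Longrightarrow>
            exec E (While b c) s (bcost b + t + t') s''"

lemma exec_deterministic:
  "exec E c s t s' \<Longrightarrow> exec E c s u r \<Longrightarrow> u = t \<and> r = s'"
proof (induction arbitrary: u r rule: exec.induct)
  case (DrawExample s x y a)
  from DrawExample(2) show ?case by cases (use DrawExample(1) in simp)
next
  case (Seq c s t s' d t' s'')
  from Seq(5) show ?case by cases (use Seq(3,4) in blast)
next
  case (CondTrue b s c t s' d)
  from CondTrue(4) show ?case by cases (use CondTrue(1,3) in blast)+
next
  case (CondFalse b s d t s' c)
  from CondFalse(4) show ?case by cases (use CondFalse(1,3) in blast)+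
next
  case (WhileFalse b s c)
  from WhileFalse(2) show ?case by cases (use WhileFalse(1) in blast)+
next
  case (WhileTrue b s c t s' t' s'')
  from WhileTrue(6) show ?case by cases (use WhileTrue(1,4,5) in blast)+
qed (erule exec.cases; simp)+


section \<open>Learning algorithms\<close>

definition initial_state :: "nat \<Rightarrow> real list \<Rightarrow> state" where
  "initial_state n ps =
    \<lparr>nreg = (\<lambda>i. if i = 0 then n else 0), rreg = (\<lambda>i. if i < length ps then ps ! i else 0),
     mem = (\<lambda>_. 0), drawn = 0\<rparr>"

text \<open>
  A learning algorithm consists of a training program and a prediction program.  The final state
  of training represents the hypothesis; its value at \<open>x\<close> is what the prediction program leaves
  in real register \<open>0\<close> when started from that state with \<open>x\<close> written at the address that
  training left in index register \<open>0\<close>.  The time bound \<open>\<tau>\<close> applies to training and to each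
  prediction; without the latter, storing the raw sample would count as a hypothesis.
\<close>

definition outputs_hypothesis ::
  "com \<Rightarrow> com \<Rightarrow> environment \<Rightarrow> real list \<Rightarrow> point set \<Rightarrow> nat \<Rightarrow> real \<Rightarrow> (point \<Rightarrow> real) \<Rightarrow> bool"
  where
  "outputs_hypothesis train predict E ps X m \<tau> h \<longleftrightarrow>
    (\<exists>t s. exec E train (initial_state (dimension E) ps) t s \<and> real t \<le> \<tau> \<and> drawn s = m \<and>
      (\<forall>x\<in>X. \<exists>t' s'.
        exec E predict (s\<lparr>mem := write_point (dimension E) (nreg s 0) x (mem s)\<rparr>) t' s' \<and>
        real t' \<le> \<tau> \<and> drawn s' = m \<and> rreg s' 0 = h x))"

definition poly_bounded :: "(nat \<Rightarrow> nat) \<Rightarrow> bool" where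
  "poly_bounded c \<longleftrightarrow> (\<exists>k. (\<lambda>n. real (c n)) \<in> O(\<lambda>n. real n ^ k))"

end

theory Submission
  imports Defs
begin

text \<open>
  Single-pass kernel gradient descent: starting from \<open>v\<^sub>0 = 0\<close>, each fresh example moves the iterate
  by \<open>v\<^sub>t\<^sub>+\<^sub>1 = v\<^sub>t + \<eta> (y\<^sub>t - u \<langle>v\<^sub>t, \<psi>(x\<^sub>t)\<rangle>) \<psi>(x\<^sub>t)\<close>, and the hypothesis is the average of the functions
  \<open>x \<mapsto> u \<langle>v\<^sub>t, \<psi>(x)\<rangle>\<close>.  By convexity of the square its risk is at most the average risk of the
  iterates, so no validation sample, and hence no union bound over the iterates, is needed.

  Let \<open>w\<close> approximate \<open>f\<close> and \<open>d\<^sub>t = \<parallel>w - v\<^sub>t\<parallel>\<^sup>2\<close>.  Then \<open>d\<^sub>t\<^sub>+\<^sub>1 \<le> d\<^sub>t - 2 \<eta> a\<^sub>t + \<eta>\<^sup>2\<close> with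
  \<open>a\<^sub>t = (y\<^sub>t - u \<langle>v\<^sub>t, \<psi>(x\<^sub>t)\<rangle>) \<langle>w - v\<^sub>t, \<psi>(x\<^sub>t)\<rangle>\<close>.  Conditionally on the past, \<open>\<bar>a\<^sub>t\<bar> \<le> \<surd>d\<^sub>t\<close>, and the
  mean of \<open>a\<^sub>t\<close> is at least \<open>1/L\<close> times the risk of \<open>v\<^sub>t\<close> minus \<open>\<epsilon>\<close>.  Hoeffding's lemma turns this
  into an exponential supermartingale in \<open>d\<^sub>t\<close>, and Markov's inequality bounds the average risk with
  the correct dependence on \<open>\<delta>\<close>.  The step size is \<open>\<eta> = \<epsilon> / j\<close> and the sample size
  \<open>\<lfloor>B\<^sup>2 j / \<epsilon>\<^sup>2\<rfloor>\<close>, where \<open>j\<close>, the least number with \<open>2\<^sup>j \<delta> \<ge> 1\<close>, replaces the logarithm, which the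
  machine cannot compute.
\<close>

section \<open>Weakest preconditions with running times\<close>

section \<open>Execution of programs\<close>

text \<open>Weakest precondition for total correctness, with the running time handed to
  \<open>Q\<close>. Because execution is deterministic, the constructs below satisfy equivalences,
  so the simplifier can execute straight-line code symbolically.\<close>

definition runs :: "environment \<Rightarrow> com \<Rightarrow> state \<Rightarrow> (nat \<Rightarrow> state \<Rightarrow> bool) \<Rightarrow> bool" where
  "runs E c s Q \<longleftrightarrow> (\<exists>t s'. exec E c s t s' \<and> Q t s')"

lemma runs_NAssign [simp]:
  "runs E (NAssign i a) s Q \<longleftrightarrow> Q (1 + ncost a) (s\<lparr>nreg := (nreg s)(i := nval a s)\<rparr>)"
  unfolding runs_def using exec.NAssign exec_deterministic by blast

lemma runs_RAssign [simp]:
  "runs E (RAssign i p) s Q \<longleftrightarrow> Q (1 + rcost p) (s\<lparr>rreg := (rreg s)(i := rval p s)\<rparr>)"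
  unfolding runs_def using exec.RAssign exec_deterministic by blast

lemma runs_Store [simp]:
  "runs E (Store a p) s Q \<longleftrightarrow>
    Q (1 + ncost a + rcost p) (s\<lparr>mem := (mem s)(nval a s := rval p s)\<rparr>)"
  unfolding runs_def using exec.Store exec_deterministic by blast

lemma runs_CallKernel [simp]:
  "runs E (CallKernel i a b) s Q \<longleftrightarrow> Q (1 + ncost a + ncost b + kernel_cost E)
    (s\<lparr>rreg := (rreg s)(i := kernel E (read_point (dimension E) (nval a s) (mem s))
                                    (read_point (dimension E) (nval b s) (mem s)))\<rparr>)"
  unfolding runs_def using exec.CallKernel exec_deterministic by blast

lemma runs_CallLink [simp]:
  "runs E (CallLink i p) s Q \<longleftrightarrow>
    Q (1 + rcost p) (s\<lparr>rreg := (rreg s)(i := link E (rval p s))\<rparr>)"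
  unfolding runs_def using exec.CallLink exec_deterministic by blast

lemma runs_DrawExample [simp]:
  "runs E (DrawExample a) s Q \<longleftrightarrow> Q (2 + ncost a + dimension E)
    (s\<lparr>mem := (write_point (dimension E) (nval a s) (fst (examples E (drawn s))) (mem s))
                (nval a s + dimension E := snd (examples E (drawn s))),
       drawn := drawn s + 1\<rparr>)"
proof -
  have "exec E (DrawExample a) s (2 + ncost a + dimension E)
    (s\<lparr>mem := (write_point (dimension E) (nval a s) (fst (examples E (drawn s))) (mem s))
                (nval a s + dimension E := snd (examples E (drawn s))),
       drawn := drawn s + 1\<rparr>)" (is "exec E ?c s ?t ?s")
    by (rule exec.DrawExample) simp
  then show ?thesis
    unfolding runs_def using exec_deterministic by blast
qed

lemma runs_Seq [simp]:
  "runs E (Seq c d) s Q \<longleftrightarrow> runs E c s (\<lambda>t s'. runs E d s' (\<lambda>t' s''. Q (t + t') s''))"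
proof
  assume "runs E (Seq c d) s Q"
  then obtain t s' where "exec E (Seq c d) s t s'" "Q t s'" unfolding runs_def by blast
  then show "runs E c s (\<lambda>t s'. runs E d s' (\<lambda>t' s''. Q (t + t') s''))"
    unfolding runs_def by cases blast
qed (auto simp: runs_def intro: exec.Seq)

lemma runs_Cond [simp]:
  "runs E (Cond b c d) s Q \<longleftrightarrow>
    (if bval b s then runs E c s (\<lambda>t. Q (bcost b + t)) else runs E d s (\<lambda>t. Q (bcost b + t)))"
proof
  assume "runs E (Cond b c d) s Q"
  then obtain t s' where "exec E (Cond b c d) s t s'" "Q t s'" unfolding runs_def by blast
  then show "if bval b s then runs E c s (\<lambda>t. Q (bcost b + t)) else runs E d s (\<lambda>t. Q (bcost b + t))"
    unfolding runs_def by cases auto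
qed (auto simp: runs_def intro: exec.CondTrue exec.CondFalse split: if_splits)

lemma runs_mono:
  assumes "runs E c s P" "\<And>t s'. P t s' \<Longrightarrow> Q t s'"
  shows "runs E c s Q"
  using assms unfolding runs_def by blast

text \<open>The invariant is indexed by the number of completed rounds, so the loop makes exactly N
  of them. The summand 1 in the time bound pays for the final failing test.\<close>

lemma runs_While:
  assumes body: "\<And>i s. i < N \<Longrightarrow> I i s \<Longrightarrow> bval b s \<and> runs E c s (\<lambda>t s'. t \<le> \<tau> \<and> I (Suc i) s')"
    and exit: "\<And>s. I N s \<Longrightarrow> \<not> bval b s"
    and init: "I 0 s"
    and post: "\<And>t s'. t \<le> (N + 1) * (bcost b + \<tau>) \<Longrightarrow> I N s' \<Longrightarrow> Q t s'"
  shows "runs E (While b c) s Q"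
proof -
  have "runs E (While b c) s (\<lambda>t s'. t \<le> (N - i + 1) * (bcost b + \<tau>) \<and> I N s')"
    if "i \<le> N" "I i s" for i s
    using that
  \<comment> \<open>Downward induction from N: what is bounded is the time of the N - i rounds still
    to come.\<close>
  proof (induction i arbitrary: s rule: inc_induct)
    case base
    then show ?case
      unfolding runs_def by (intro exI[of _ "bcost b"] exI[of _ s]) (simp add: exec.WhileFalse exit)
  next
    case (step i)
    obtain t s' where 1: "exec E c s t s'" "t \<le> \<tau>" "I (Suc i) s'" and b: "bval b s"
      using body[OF step(2,4)] unfolding runs_def by blast
    obtain t' s'' where 2: "exec E (While b c) s' t' s''"
      "t' \<le> (N - Suc i + 1) * (bcost b + \<tau>)" "I N s''"
      using step.IH[OF 1(3)] unfolding runs_def by blast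
    have "N - i = Suc (N - Suc i)" using step(2) by simp
    then have "bcost b + t + t' \<le> (N - i + 1) * (bcost b + \<tau>)"
      using 1(2) 2(2) by simp
    then show ?case
      unfolding runs_def using exec.WhileTrue[OF b 1(1) 2(1)] 2(3) by blast
  qed
  from this[of 0 s] init have "runs E (While b c) s (\<lambda>t s'. t \<le> (N + 1) * (bcost b + \<tau>) \<and> I N s')"
    by simp
  then show ?thesis by (rule runs_mono) (use post in blast)
qed

section \<open>Iterates, hypothesis and programs\<close>

section \<open>The algorithm\<close>

text \<open>The iterate v_t is represented by its values, as a kernel expansion over the examples
  read so far. One evaluation therefore costs t kernel calls, and no element of the Hilbert space
  has to be stored.\<close>

primrec iterate ::
  "(point \<Rightarrow> point \<Rightarrow> real) \<Rightarrow> (real \<Rightarrow> real) \<Rightarrow> real \<Rightarrow> (nat \<Rightarrow> example) \<Rightarrow> nat \<Rightarrow> point \<Rightarrow> real"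
  where
  "iterate K u \<eta> \<omega> 0 x = 0"
| "iterate K u \<eta> \<omega> (Suc t) x = iterate K u \<eta> \<omega> t x
    + \<eta> * (snd (\<omega> t) - u (iterate K u \<eta> \<omega> t (fst (\<omega> t)))) * K (fst (\<omega> t)) x"

definition step_coeff ::
  "(point \<Rightarrow> point \<Rightarrow> real) \<Rightarrow> (real \<Rightarrow> real) \<Rightarrow> real \<Rightarrow> (nat \<Rightarrow> example) \<Rightarrow> nat \<Rightarrow> real" where
  "step_coeff K u \<eta> \<omega> t = \<eta> * (snd (\<omega> t) - u (iterate K u \<eta> \<omega> t (fst (\<omega> t))))"

text \<open>Without samples the prediction is u 0, that of the zero iterate. This case arises when
  B^2 j < \<epsilon>^2.\<close>

definition averaged ::
  "(point \<Rightarrow> point \<Rightarrow> real) \<Rightarrow> (real \<Rightarrow> real) \<Rightarrow> real \<Rightarrow> nat \<Rightarrow> (nat \<Rightarrow> example) \<Rightarrow> point \<Rightarrow> real" where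
  "averaged K u \<eta> T \<omega> x = (if T = 0 then u 0 else (\<Sum>t<T. u (iterate K u \<eta> \<omega> t x)) / real T)"

definition doublings :: "real \<Rightarrow> nat" where
  "doublings \<delta> = (LEAST j. 1 \<le> 2 ^ j * \<delta>)"

definition sample_size :: "real \<Rightarrow> real \<Rightarrow> real \<Rightarrow> nat" where
  "sample_size B \<epsilon> \<delta> = nat \<lfloor>B\<^sup>2 * real (doublings \<delta>) / \<epsilon>\<^sup>2\<rfloor>"

definition rate :: "real \<Rightarrow> real \<Rightarrow> real" where
  "rate \<epsilon> \<delta> = \<epsilon> / real (doublings \<delta>)"

text \<open>
  Block \<open>t\<close> of the memory starts at address \<open>t * (n + 1)\<close> and holds the point of example \<open>t\<close>
  followed by its coefficient, which overwrites the label.  Index register \<open>0\<close> points to the first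
  free block, \<open>1\<close> holds \<open>n\<close>, \<open>2\<close> scans the blocks.  Real registers: \<open>0\<close>, \<open>3\<close>, \<open>4\<close> are the
  parameters \<open>B\<close>, \<open>\<epsilon>\<close>, \<open>\<delta>\<close>; \<open>5\<close> is the number of doublings, \<open>6\<close> the number of blocks, \<open>7\<close> the
  value of the current iterate, \<open>10\<close> the sum of predictions.
\<close>

definition add_block :: com where
  "add_block = Seq (CallKernel 8 (NReg 2) (NReg 0))
    (Seq (RAssign 7 (RPlus (RReg 7) (RTimes (RMem (NPlus (NReg 2) (NReg 1))) (RReg 8))))
    (NAssign 2 (NPlus (NReg 2) (NPlus (NReg 1) (NConst 1)))))"

definition double_delta :: com where
  "double_delta = While (RLess (RReg 4) (RConst 1))
    (Seq (RAssign 4 (RPlus (RReg 4) (RReg 4))) (RAssign 5 (RPlus (RReg 5) (RConst 1))))"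

definition process_example :: com where
  "process_example = Seq (DrawExample (NReg 0))
    (Seq (RAssign 7 (RConst 0))
    (Seq (NAssign 2 (NConst 0))
    (Seq (While (NLess (NReg 2) (NReg 0)) add_block)
    (Seq (CallLink 9 (RReg 7))
    (Seq (Store (NPlus (NReg 0) (NReg 1))
           (RTimes (RDivide (RReg 3) (RReg 5)) (RMinus (RMem (NPlus (NReg 0) (NReg 1))) (RReg 9))))
    (Seq (RAssign 6 (RPlus (RReg 6) (RConst 1)))
    (NAssign 0 (NPlus (NReg 0) (NPlus (NReg 1) (NConst 1))))))))))"

definition train_prog :: com where
  "train_prog = Seq (NAssign 1 (NReg 0))
    (Seq (NAssign 0 (NConst 0))
    (Seq double_delta
    (While (Neg (RLess (RTimes (RTimes (RReg 0) (RReg 0)) (RReg 5))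
                       (RTimes (RPlus (RReg 6) (RConst 1)) (RTimes (RReg 3) (RReg 3)))))
      process_example)))"

definition predict_prog :: com where
  "predict_prog = Seq (RAssign 7 (RConst 0))
    (Seq (RAssign 10 (RConst 0))
    (Seq (NAssign 2 (NConst 0))
    (Seq (While (NLess (NReg 2) (NReg 0))
      (Seq (CallLink 9 (RReg 7)) (Seq (RAssign 10 (RPlus (RReg 10) (RReg 9))) add_block)))
    (Cond (NLess (NConst 0) (NReg 0))
      (RAssign 0 (RDivide (RReg 10) (RReg 6)))
      (CallLink 0 (RConst 0))))))"

section \<open>Correctness and running time of the two programs\<close>

definition stored :: "nat \<Rightarrow> (nat \<Rightarrow> point) \<Rightarrow> (nat \<Rightarrow> real) \<Rightarrow> nat \<Rightarrow> (nat \<Rightarrow> real) \<Rightarrow> bool" where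
  "stored n xs \<alpha> t \<mu> \<longleftrightarrow>
    (\<forall>s<t. read_point n (s * (n + 1)) \<mu> = xs s \<and> \<mu> (s * (n + 1) + n) = \<alpha> s)"

text \<open>The next example and the query point are written from block t onwards, so such writes
  leave the stored prefix intact.\<close>

lemma stored_cong:
  assumes "stored n xs \<alpha> t \<mu>" "\<And>a. a < t * (n + 1) \<Longrightarrow> \<mu>' a = \<mu> a"
  shows "stored n xs \<alpha> t \<mu>'"
proof -
  have *: "s * (n + 1) + i < t * (n + 1)" if "s < t" "i \<le> n" for s i
  proof -
    have "(s + 1) * (n + 1) \<le> t * (n + 1)" using that by (intro mult_right_mono) auto
    then show ?thesis using that by (simp add: algebra_simps)
  qed
  have "\<mu>' (s * (n + 1) + i) = \<mu> (s * (n + 1) + i)" if "s < t" "i \<le> n" for s i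
    using assms(2) *[OF that] by blast
  then show ?thesis
    using assms(1) unfolding stored_def read_point_def
    by (metis (no_types, lifting) lessThan_iff less_imp_le order_refl restrict_ext)
qed

lemma read_write_point:
  "x \<in> extensional {..<n} \<Longrightarrow> read_point n a (write_point n a x \<mu>) = x"
  by (auto simp: read_point_def write_point_def fun_eq_iff extensional_def)

lemma read_point_upd:
  "read_point n a (\<mu>(a + n := y)) = read_point n a \<mu>"
  by (auto simp: read_point_def fun_eq_iff)

text \<open>Absorbing block i is one step of the recursion of \<open>iterate\<close>, so after i
  rounds register 7 holds v_i at x. A round costs 18 + \<kappa> for the body and 3 for the
  guard.\<close>

lemma runs_scan:
  assumes E: "dimension E = n" "kernel E = K" "kernel_cost E = \<kappa>"
    and st: "stored n (\<lambda>i. fst (\<omega> i)) (step_coeff K u \<eta> \<omega>) t (mem s)"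
    and x: "read_point n (t * (n + 1)) (mem s) = x"
    and s: "nreg s 0 = t * (n + 1)" "nreg s 1 = n" "nreg s 2 = 0" "rreg s 7 = 0"
    and Q: "\<And>\<tau> s'. \<tau> \<le> (t + 1) * (21 + \<kappa>) \<Longrightarrow> mem s' = mem s \<Longrightarrow> drawn s' = drawn s \<Longrightarrow>
      (\<And>r. r \<noteq> 2 \<Longrightarrow> nreg s' r = nreg s r) \<Longrightarrow> (\<And>r. r \<noteq> 7 \<Longrightarrow> r \<noteq> 8 \<Longrightarrow> rreg s' r = rreg s r) \<Longrightarrow>
      rreg s' 7 = iterate K u \<eta> \<omega> t x \<Longrightarrow> Q \<tau> s'"
  shows "runs E (While (NLess (NReg 2) (NReg 0)) add_block) s Q"
proof (rule runs_While[where N = t and \<tau> = "18 + \<kappa>" and I = "\<lambda>i s'. mem s' = mem s \<and> drawn s' = drawn s \<and>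
    (\<forall>r. r \<noteq> 2 \<longrightarrow> nreg s' r = nreg s r) \<and> nreg s' 2 = i * (n + 1) \<and>
    (\<forall>r. r \<noteq> 7 \<longrightarrow> r \<noteq> 8 \<longrightarrow> rreg s' r = rreg s r) \<and> rreg s' 7 = iterate K u \<eta> \<omega> i x"], goal_cases)
  case (1 i s')
  have st': "read_point n (i * (n + 1)) (mem s) = fst (\<omega> i)"
    "mem s (i * (n + 1) + n) = step_coeff K u \<eta> \<omega> i"
    using st 1 unfolding stored_def by auto
  have "i + i * n < t + t * n" using 1 by (intro add_less_le_mono) auto
  then show ?case
    using 1 s x E st' unfolding add_block_def by (simp add: step_coeff_def)
next
  case (2 s') then show ?case using s by simp
next
  case 3 then show ?case using s by simp
next
  case (4 \<tau> s') then show ?case by (intro Q) (auto simp: add.commute)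
qed

text \<open>One scan yields all T predictions: v_i at x is in register 7 just before block i is
  absorbed, and its link value is added to the sum at that moment.\<close>

lemma runs_predict:
  assumes E: "dimension E = n" "kernel E = K" "kernel_cost E = \<kappa>" "link E = u"
    and st: "stored n (\<lambda>i. fst (\<omega> i)) (step_coeff K u \<eta> \<omega>) T (mem s)"
    and x: "read_point n (T * (n + 1)) (mem s) = x"
    and s: "nreg s 0 = T * (n + 1)" "nreg s 1 = n" "rreg s 6 = T"
  shows "runs E predict_prog s (\<lambda>\<tau> s'. \<tau> \<le> (T + 2) * (40 + \<kappa>) \<and> drawn s' = drawn s \<and>
    rreg s' 0 = averaged K u \<eta> T \<omega> x)"
  unfolding predict_prog_def
  apply simp
proof (rule runs_While[where N = T and \<tau> = "25 + \<kappa>" and I = "\<lambda>i s'. mem s' = mem s \<and> drawn s' = drawn s \<and>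
    (\<forall>r. r \<noteq> 2 \<longrightarrow> nreg s' r = nreg s r) \<and> nreg s' 2 = i * (n + 1) \<and>
    rreg s' 6 = rreg s 6 \<and> rreg s' 7 = iterate K u \<eta> \<omega> i x \<and>
    rreg s' 10 = (\<Sum>t<i. u (iterate K u \<eta> \<omega> t x))"], goal_cases)
  case (1 i s')
  have st': "read_point n (i * (n + 1)) (mem s) = fst (\<omega> i)"
    "mem s (i * (n + 1) + n) = step_coeff K u \<eta> \<omega> i"
    using st 1 unfolding stored_def by auto
  have "i + i * n < T + T * n" using 1 by (intro add_less_le_mono) auto
  then show ?case
    using 1 s x E st' unfolding add_block_def by (simp add: step_coeff_def)
next
  case (2 s') then show ?case using s by simp
next
  case 3 then show ?case using s by simp
next
  \<comment> \<open>Index register 0 holds T * (n + 1), so its positivity decides whether T =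
    0.\<close>
  case (4 \<tau> s') then show ?case
    using s E by (auto simp: averaged_def algebra_simps)
qed

text \<open>The number of doublings is log_2 (1 / \<delta>) rounded up. The two logarithmic bounds
  follow from ln 2 < 1 and ln 2 > 1/2; the first two claims drive the loop of
  \<open>double_delta\<close>.\<close>

lemma doublings:
  assumes "0 < \<delta>" "\<delta> < 1"
  shows "1 \<le> 2 ^ doublings \<delta> * \<delta>" "i < doublings \<delta> \<Longrightarrow> 2 ^ i * \<delta> < 1"
    "1 \<le> doublings \<delta>" "ln (1 / \<delta>) \<le> doublings \<delta>" "doublings \<delta> \<le> 1 + 2 * ln (1 / \<delta>)"
proof -
  obtain j where "1 / \<delta> < 2 ^ j" using real_arch_pow[of 2 "1 / \<delta>"] by auto
  then have "1 \<le> 2 ^ j * \<delta>" using assms by (simp add: field_simps)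
  then show 1: "1 \<le> 2 ^ doublings \<delta> * \<delta>" unfolding doublings_def by (rule LeastI)
  show 2: "2 ^ i * \<delta> < 1" if "i < doublings \<delta>" for i
    using not_less_Least[of i "\<lambda>j. 1 \<le> 2 ^ j * \<delta>"] that unfolding doublings_def by simp
  show 3: "1 \<le> doublings \<delta>" using 1 assms by (cases "doublings \<delta>") auto
  have "1 / \<delta> \<le> 2 ^ doublings \<delta>" using 1 assms by (simp add: field_simps)
  then have "ln (1 / \<delta>) \<le> ln (2 ^ doublings \<delta>)" using assms by (subst ln_le_cancel_iff) auto
  also have "\<dots> = doublings \<delta> * ln 2" by (simp add: ln_realpow)
  also have "\<dots> \<le> real (doublings \<delta>) * 1" using ln_2_less_1 by (intro mult_left_mono) auto
  finally show "ln (1 / \<delta>) \<le> doublings \<delta>" by simp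
  have "2 ^ (doublings \<delta> - 1) < 1 / \<delta>" using 2[of "doublings \<delta> - 1"] 3 assms by (simp add: field_simps)
  then have "ln (2 ^ (doublings \<delta> - 1)) < ln (1 / \<delta>)" using assms by (subst ln_less_cancel_iff) auto
  then have "real (doublings \<delta> - 1) * ln 2 < ln (1 / \<delta>)" by (simp add: ln_realpow)
  moreover have "real (doublings \<delta> - 1) * (1 / 2) \<le> real (doublings \<delta> - 1) * ln 2"
    using ln2_ge_two_thirds by (intro mult_left_mono) auto
  ultimately show "doublings \<delta> \<le> 1 + 2 * ln (1 / \<delta>)" using 3 by (simp add: of_nat_diff)
qed

lemma runs_process:
  assumes E: "dimension E = n" "kernel E = K" "kernel_cost E = \<kappa>" "link E = u" "examples E = \<omega>"
    and \<omega>: "fst (\<omega> t) \<in> extensional {..<n}"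
    and st: "stored n (\<lambda>i. fst (\<omega> i)) (step_coeff K u \<eta> \<omega>) t (mem s)"
    and s: "nreg s 0 = t * (n + 1)" "nreg s 1 = n" "rreg s 3 / rreg s 5 = \<eta>" "drawn s = t"
  shows "runs E process_example s (\<lambda>\<tau> s'. \<tau> \<le> (t + 2) * (40 + n + \<kappa>) \<and> drawn s' = t + 1 \<and>
    stored n (\<lambda>i. fst (\<omega> i)) (step_coeff K u \<eta> \<omega>) (t + 1) (mem s') \<and>
    nreg s' 0 = (t + 1) * (n + 1) \<and> nreg s' 1 = n \<and> rreg s' 6 = rreg s 6 + 1 \<and>
    rreg s' 0 = rreg s 0 \<and> rreg s' 3 = rreg s 3 \<and> rreg s' 5 = rreg s 5)"
  unfolding process_example_def
  apply simp
proof (rule runs_scan[where n = n and K = K and \<kappa> = \<kappa> and \<omega> = \<omega> and u = u and \<eta> = \<eta> and t = t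
      and x = "fst (\<omega> t)"], goal_cases)
  case 4
  show ?case by (rule stored_cong[OF st]) (simp add: E s write_point_def)
next
  case 5
  show ?case using \<omega> s E by (simp add: read_point_upd read_write_point)
next
  case (10 \<tau> s')
  \<comment> \<open>The memory after the final store, in which the label of example t has become its
    coefficient.\<close>
  let ?\<mu> = "(mem s')(nreg s' 0 + nreg s' (Suc 0) :=
                 (rreg s' 3 / rreg s' 5) * (mem s' (nreg s' 0 + nreg s' (Suc 0)) - u (rreg s' 7)))"
  have "mem s' (t * (n + 1) + n) = snd (\<omega> t)"
    using 10 E s by simp
  then have v: "?\<mu> (t * (n + 1) + n) = step_coeff K u \<eta> \<omega> t"
    using 10 s by (simp add: step_coeff_def)
  have st1: "stored n (\<lambda>i. fst (\<omega> i)) (step_coeff K u \<eta> \<omega>) t ?\<mu>"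
    by (rule stored_cong[OF st]) (use 10 s E in \<open>simp add: write_point_def\<close>)
  have r: "read_point n (t * (n + 1)) ?\<mu> = fst (\<omega> t)"
    using 10 s E \<omega> by (simp add: read_point_upd read_write_point)
  have "stored n (\<lambda>i. fst (\<omega> i)) (step_coeff K u \<eta> \<omega>) (t + 1) ?\<mu>"
    using st1 r v unfolding stored_def by (auto simp: less_Suc_eq)
  moreover have "\<tau> + (n + 40) \<le> (t + 2) * (40 + n + \<kappa>)"
  proof -
    have "(t + 1) * (21 + \<kappa>) \<le> (t + 1) * (40 + n + \<kappa>)" by (intro mult_left_mono) auto
    moreover have "(t + 2) * (40 + n + \<kappa>) = (t + 1) * (40 + n + \<kappa>) + (40 + n + \<kappa>)" by simp
    ultimately show ?thesis using 10(1) by linarith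
  qed
  \<comment> \<open>Simplification moves the division outwards, so the step size is needed in this
    form.\<close>
  moreover have "rreg s 3 * a / rreg s 5 = \<eta> * a" for a
    using s(3) by (metis times_divide_eq_left)
  ultimately show ?case using 10 s E by (simp add: add_ac)
qed (use E s in auto)

text \<open>The right-hand side is the guard of the training loop, free of division and rounding, so
  the machine draws exactly \<open>sample_size\<close> examples without computing a floor. Its
  failure at i = T bounds T from below, which the risk bound uses.\<close>

lemma less_sample_size_iff:
  assumes "0 < \<epsilon>"
  shows "i < sample_size B \<epsilon> \<delta> \<longleftrightarrow> (real i + 1) * \<epsilon>\<^sup>2 \<le> B\<^sup>2 * real (doublings \<delta>)"
proof -
  have "i < sample_size B \<epsilon> \<delta> \<longleftrightarrow> int i + 1 \<le> \<lfloor>B\<^sup>2 * real (doublings \<delta>) / \<epsilon>\<^sup>2\<rfloor>"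
    unfolding sample_size_def by linarith
  also have "\<dots> \<longleftrightarrow> real i + 1 \<le> B\<^sup>2 * real (doublings \<delta>) / \<epsilon>\<^sup>2" by (simp add: le_floor_iff)
  finally show ?thesis using assms by (simp add: field_simps)
qed

text \<open>Two successive loops: doubling \<delta>, then processing examples. The time is quadratic
  in T because each example triggers a scan of all earlier blocks.\<close>

lemma runs_train:
  assumes E: "dimension E = n" "kernel E = K" "kernel_cost E = \<kappa>" "link E = u" "examples E = \<omega>"
    and par: "0 < \<epsilon>" "0 < \<delta>" "\<delta> < 1"
    and T: "T = sample_size B \<epsilon> \<delta>" and \<eta>: "\<eta> = rate \<epsilon> \<delta>"
    and \<omega>: "\<And>i. i < T \<Longrightarrow> fst (\<omega> i) \<in> extensional {..<n}"
  shows "runs E train_prog (initial_state n [B, M, L, \<epsilon>, \<delta>])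
    (\<lambda>\<tau> s. \<tau> \<le> 20 * doublings \<delta> + (T + 2)\<^sup>2 * (100 + n + \<kappa>) \<and> drawn s = T \<and>
      stored n (\<lambda>i. fst (\<omega> i)) (step_coeff K u \<eta> \<omega>) T (mem s) \<and>
      nreg s 0 = T * (n + 1) \<and> nreg s 1 = n \<and> rreg s 6 = T)"
  unfolding train_prog_def double_delta_def
  apply simp
proof (rule runs_While[where N = "doublings \<delta>" and \<tau> = 10 and I = "\<lambda>i s. rreg s 4 = 2 ^ i * \<delta> \<and>
    rreg s 5 = i \<and> rreg s 0 = B \<and> rreg s 3 = \<epsilon> \<and> rreg s 6 = 0 \<and> drawn s = 0 \<and>
    nreg s 0 = 0 \<and> nreg s 1 = n"], goal_cases)
  case (1 i s) then show ?case using doublings(2)[OF par(2,3), of i] by simp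
next
  case (2 s) then show ?case using doublings(1)[OF par(2,3)] by simp
next
  case 3 then show ?case by (simp add: initial_state_def)
next
  case (4 t s)
  show ?case
  proof (rule runs_While[where N = T and \<tau> = "(T + 1) * (40 + n + \<kappa>)" and I = "\<lambda>i s.
      drawn s = i \<and> stored n (\<lambda>i. fst (\<omega> i)) (step_coeff K u \<eta> \<omega>) i (mem s) \<and>
      nreg s 0 = i * (n + 1) \<and> nreg s 1 = n \<and> rreg s 6 = i \<and>
      rreg s 0 = B \<and> rreg s 3 = \<epsilon> \<and> rreg s 5 = doublings \<delta>"], goal_cases)
    case (1 i s)
    have b: "(i + 2) * (40 + n + \<kappa>) \<le> (T + 1) * (40 + n + \<kappa>)"
      using 1 by (intro mult_right_mono) auto
    have "runs E process_example s (\<lambda>\<tau> s'. \<tau> \<le> (i + 2) * (40 + n + \<kappa>) \<and> drawn s' = i + 1 \<and>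
    stored n (\<lambda>i. fst (\<omega> i)) (step_coeff K u \<eta> \<omega>) (i + 1) (mem s') \<and>
    nreg s' 0 = (i + 1) * (n + 1) \<and> nreg s' 1 = n \<and> rreg s' 6 = rreg s 6 + 1 \<and>
    rreg s' 0 = rreg s 0 \<and> rreg s' 3 = rreg s 3 \<and> rreg s' 5 = rreg s 5)"
      using 1 E \<omega> \<eta> by (intro runs_process) (auto simp: rate_def)
    then have "runs E process_example s (\<lambda>t s'. t \<le> (T + 1) * (40 + n + \<kappa>) \<and> (drawn s' = Suc i \<and>
      stored n (\<lambda>i. fst (\<omega> i)) (step_coeff K u \<eta> \<omega>) (Suc i) (mem s') \<and>
      nreg s' 0 = Suc i * (n + 1) \<and> nreg s' 1 = n \<and> rreg s' 6 = Suc i \<and>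
      rreg s' 0 = B \<and> rreg s' 3 = \<epsilon> \<and> rreg s' 5 = doublings \<delta>))"
      by (rule runs_mono) (use 1 b in auto)
    moreover have "(real i + 1) * \<epsilon>\<^sup>2 \<le> B\<^sup>2 * real (doublings \<delta>)"
      using 1 T less_sample_size_iff[OF par(1)] by simp
    ultimately show ?case using 1 by (simp add: power2_eq_square)
  next
    case (2 s)
    then show ?case using T less_sample_size_iff[OF par(1), of T B \<delta>]
      by (simp add: power2_eq_square)
  next
    case 3 then show ?case using 4 by (simp add: stored_def)
  next
    case (4 t' s')
    define Z where "Z = (T + 2)\<^sup>2 * (100 + n + \<kappa>)"
    have "1 \<le> doublings \<delta>" using doublings(3) par by blast
    \<comment> \<open>A round costs 3 for the guard and at most 10 for the body. As there is at
      least one doubling, 13 (j + 1) exceeds 20 j by at most 6, which the slack 60 below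
      absorbs.\<close>
    moreover have "t \<le> (doublings \<delta> + 1) * 13" using \<open>t \<le> _\<close> by simp
    moreover have "t' + 60 \<le> (T + 1) * (14 + (T + 1) * (40 + n + \<kappa>)) + 60" using 4(1) by simp
    then have "t' + 60 \<le> Z"
      by (rule order_trans) (simp add: Z_def power2_eq_square algebra_simps)
    ultimately have "t + t' + 10 \<le> 20 * doublings \<delta> + Z" by simp
    then show ?case unfolding Z_def using 4(2) by simp
  qed
qed

section \<open>Gradient steps in the kernel space\<close>

context rkhs
begin

text \<open>Acts on the residual w - v_t: when the iterate gains a \<psi>(x), the residual loses
  it.\<close>

definition descend :: "(point \<Rightarrow> real) \<Rightarrow> real \<Rightarrow> point \<Rightarrow> (point \<Rightarrow> real)" where
  "descend g a x = lin_comb X 1 g (- a) (feature X K x)"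

lemma descend_mem: "g \<in> H \<Longrightarrow> x \<in> X \<Longrightarrow> descend g a x \<in> H"
  unfolding descend_def by (intro lin_comb_mem feature_mem)

lemma descend_apply: "y \<in> X \<Longrightarrow> descend g a x y = g y - a * K x y"
  by (simp add: descend_def lin_comb_def feature_def)

lemma ip_descend:
  assumes g: "g \<in> H" and x: "x \<in> X"
  shows "ip (descend g a x) (descend g a x) = ip g g - 2 * a * g x + a\<^sup>2 * K x x"
proof -
  note \<psi> = feature_mem[OF x]
  have 1: "ip g (descend g a x) = ip g g - a * g x"
    unfolding ip_commute[OF g descend_mem[OF g x]]
    unfolding descend_def ip_lin_comb[OF g \<psi> g]
    by (simp add: ip_commute[OF \<psi> g] reproducing g x)
  have 2: "ip (feature X K x) (descend g a x) = g x - a * K x x"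
    unfolding ip_commute[OF \<psi> descend_mem[OF g x]] reproducing[OF descend_mem[OF g x] x]
    by (rule descend_apply[OF x])
  have "ip (descend g a x) (descend g a x) = ip g (descend g a x) - a * ip (feature X K x) (descend g a x)"
    unfolding descend_def[of g a x]
    by (subst ip_lin_comb[OF g \<psi>]) (auto simp: descend_def[symmetric] intro: descend_mem g x)
  also have "\<dots> = ip g g - 2 * a * g x + a\<^sup>2 * K x x"
    unfolding 1 2 by (simp add: algebra_simps power2_eq_square)
  finally show ?thesis .
qed

text \<open>Cauchy-Schwarz for g and \<psi>(x), proved by descending from g with the coefficient a =
  g x and using that the result has nonnegative squared norm.\<close>

lemma apply_squared_le:
  assumes g: "g \<in> H" and x: "x \<in> X" and "K x x \<le> 1"
  shows "(g x)\<^sup>2 \<le> ip g g"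
proof -
  have "0 \<le> ip g g - 2 * g x * g x + (g x)\<^sup>2 * K x x"
    using ip_nonneg[OF descend_mem[OF g x]] ip_descend[OF g x] by metis
  moreover have "(g x)\<^sup>2 * K x x \<le> (g x)\<^sup>2 * 1"
    using assms(3) by (intro mult_left_mono) auto
  ultimately show ?thesis by (simp add: power2_eq_square)
qed

end

section \<open>The learning problem and its surrogate loss\<close>

lemma space_domain_space: "X \<subseteq> space (points n) \<Longrightarrow> space (domain_space n X) = X"
  by (auto simp: domain_space_def space_restrict_space)

lemma fst_measurable_example:
  "sets D = sets (example_space n X) \<Longrightarrow> fst \<in> measurable D (domain_space n X)"
  by (subst measurable_cong_sets[OF _ refl, of D "example_space n X"]) (auto simp: example_space_def)

text \<open>Here \<open>w\<close> is the approximating element of the RKHS, treated as a function on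
  X. Its error is stated over D instead of the marginal because all later integrals run over
  examples.\<close>

locale sgd = rkhs X K H ip + prob_space D
  for X K H ip and D :: "example measure" +
  fixes n :: nat and u :: "real \<Rightarrow> real" and f w :: "point \<Rightarrow> real" and L \<epsilon> M \<eta> :: real
  assumes X: "X \<subseteq> space (points n)"
    and sets_D: "sets D = sets (example_space n X)"
    and lipschitz: "L-lipschitz_on UNIV u"
    and mono: "mono u"
    and range: "range u \<subseteq> {0..1}"
    and f [measurable]: "f \<in> borel_measurable (domain_space n X)"
    and regression: "AE z in D. cond_mean n X D z = u (f (fst z))"
    and K_measurable: "(\<lambda>(x, x'). K x x') \<in> borel_measurable (domain_space n X \<Otimes>\<^sub>M domain_space n X)"
    and K_le: "\<And>x. x \<in> X \<Longrightarrow> K x x \<le> 1"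
    and \<epsilon>: "0 < \<epsilon>" and \<eta>: "0 < \<eta>"
    and w_mem: "w \<in> H"
    and w [measurable]: "w \<in> borel_measurable (domain_space n X)"
    and w_bound: "\<And>x. x \<in> X \<Longrightarrow> \<bar>f x - w x\<bar> \<le> M"
    and w_error: "(\<integral>z. (f (fst z) - w (fst z))\<^sup>2 \<partial>D) \<le> \<epsilon>\<^sup>2"
begin

abbreviation S where "S \<equiv> domain_space n X"

lemma space_S [simp]: "space S = X"
  by (rule space_domain_space[OF X])

lemma space_D: "space D = X \<times> {0..1}"
proof -
  have "space D = space (example_space n X)" by (rule sets_eq_imp_space_eq[OF sets_D])
  then show ?thesis by (simp add: example_space_def space_pair_measure space_restrict_space)
qed

lemma fst_measurable [measurable]: "fst \<in> measurable D S"
  by (rule fst_measurable_example[OF sets_D])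

lemma snd_measurable [measurable]: "snd \<in> borel_measurable D"
proof -
  have "(\<lambda>z. snd z) \<in> measurable (example_space n X) (restrict_space borel {0..1})"
    unfolding example_space_def by measurable
  then have "snd \<in> borel_measurable (example_space n X)"
    by (simp add: measurable_restrict_space2_iff)
  then show ?thesis unfolding measurable_cong_sets[OF sets_D refl] .
qed

lemma cond_mean_measurable [measurable]: "cond_mean n X D \<in> borel_measurable D"
  unfolding cond_mean_def by (rule borel_measurable_cond_exp2)

lemma u_measurable [measurable]: "u \<in> borel_measurable borel"
  using mono by (rule borel_measurable_mono)

lemma u_bounds: "0 \<le> u x" "u x \<le> 1"
  using range by (auto simp: image_subset_iff)

lemma L_nonneg: "0 \<le> L"
  using lipschitz by (rule lipschitz_on_nonneg)

lemma u_lipschitz: "\<bar>u x - u y\<bar> \<le> L * \<bar>x - y\<bar>"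
  using lipschitz_onD[OF lipschitz, of x y] by (simp add: dist_real_def)

lemma u_mult_nonneg: "0 \<le> (u x - u y) * (x - y)"
  using monoD[OF mono, of x y] monoD[OF mono, of y x]
  by (cases "x \<le> y") (auto simp: mult_nonneg_nonneg mult_nonpos_nonpos)

text \<open>One factor is bounded by the Lipschitz property, and monotonicity removes the absolute
  value. Integrated, this bounds the risk by L times the surrogate loss.\<close>

lemma u_square_le: "(u x - u y)\<^sup>2 \<le> L * ((u x - u y) * (x - y))"
proof -
  have "(u x - u y)\<^sup>2 = \<bar>u x - u y\<bar> * \<bar>u x - u y\<bar>" by (simp add: power2_eq_square)
  also have "\<dots> \<le> \<bar>u x - u y\<bar> * (L * \<bar>x - y\<bar>)"
    by (intro mult_left_mono u_lipschitz) auto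
  also have "\<dots> = L * \<bar>(u x - u y) * (x - y)\<bar>" by (simp add: abs_mult)
  finally show ?thesis using u_mult_nonneg by simp
qed

text \<open>The surrogate loss: up to the factor \<open>L\<close> it dominates the risk, and it is what a gradient
  step decreases in expectation.\<close>

definition surrogate :: "(point \<Rightarrow> real) \<Rightarrow> real" where
  "surrogate p = (\<integral>z. (u (f (fst z)) - u (p (fst z))) * (f (fst z) - p (fst z)) \<partial>D)"

lemma surrogate_nonneg: "0 \<le> surrogate p"
  unfolding surrogate_def by (intro integral_nonneg_AE) (simp add: u_mult_nonneg)

text \<open>The factor depending on the point is measurable for the \<sigma>-algebra generated by
  the point, so under the integral the label may be replaced by its conditional mean, which is u of
  f.\<close>

lemma regression_integral:
  assumes [measurable]: "h \<in> borel_measurable S" and b: "\<And>x. x \<in> X \<Longrightarrow> \<bar>h x\<bar> \<le> b"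
  shows "(\<integral>z. h (fst z) * snd z \<partial>D) = (\<integral>z. h (fst z) * u (f (fst z)) \<partial>D)"
proof -
  let ?F = "vimage_algebra (space D) fst S"
  have sub: "subalgebra D ?F"
    unfolding subalgebra_def using measurable_sets[OF fst_measurable]
    by (auto simp: sets_vimage_algebra2[OF measurable_space[OF fst_measurable, THEN funcsetI]])
  interpret F: finite_measure_subalgebra D ?F
    by unfold_locales (rule sub)
  have [measurable]: "fst \<in> measurable ?F S"
    by (rule measurable_vimage_algebra1) (use space_D in auto)
  have int: "integrable D (\<lambda>z. h (fst z) * snd z)"
  proof (rule integrable_const_bound[where B = "b"])
    have "norm (h (fst z) * snd z) \<le> b" if "z \<in> space D" for z
    proof -
      have "\<bar>h (fst z)\<bar> * \<bar>snd z\<bar> \<le> b * 1"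
        using b[of "fst z"] that space_D by (intro mult_mono) auto
      then show ?thesis by (simp add: abs_mult)
    qed
    then show "AE z in D. norm (h (fst z) * snd z) \<le> b" by auto
  qed measurable
  have "(\<integral>z. h (fst z) * snd z \<partial>D) = (\<integral>z. h (fst z) * cond_mean n X D z \<partial>D)"
    unfolding cond_mean_def by (rule F.real_cond_exp_intg(2)[symmetric]) (use int in measurable)
  also have "\<dots> = (\<integral>z. h (fst z) * u (f (fst z)) \<partial>D)"
  proof (rule integral_cong_AE)
    show "(\<lambda>z. h (fst z) * cond_mean n X D z) \<in> borel_measurable D" by measurable
  qed (use regression in auto)
  finally show ?thesis .
qed

text \<open>The passage from L2 to L1 uses the pointwise inequality \<bar>a\<bar> \<le> a^2 / (2
  \<epsilon>) + \<epsilon> / 2; the uniform bound M supplies integrability.\<close>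

lemma residual_L1: "(\<integral>z. \<bar>f (fst z) - w (fst z)\<bar> \<partial>D) \<le> \<epsilon>"
    and residual_integrable: "integrable D (\<lambda>z. \<bar>f (fst z) - w (fst z)\<bar>)"
proof -
  let ?\<xi> = "\<lambda>z. f (fst z) - w (fst z)"
  show 1: "integrable D (\<lambda>z. \<bar>?\<xi> z\<bar>)"
    by (rule integrable_const_bound[where B = M]) (use w_bound space_D in auto)
  have 2: "integrable D (\<lambda>z. (?\<xi> z)\<^sup>2)"
  proof (rule integrable_const_bound[where B = "M\<^sup>2"])
    have "(?\<xi> z)\<^sup>2 \<le> M\<^sup>2" if "z \<in> space D" for z
      using w_bound[of "fst z"] that space_D power_mono[of "\<bar>?\<xi> z\<bar>" M 2] by auto
    then show "AE z in D. norm ((?\<xi> z)\<^sup>2) \<le> M\<^sup>2" by auto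
  qed measurable
  have "\<bar>a\<bar> \<le> a\<^sup>2 / (2 * \<epsilon>) + \<epsilon> / 2" for a
  proof -
    have "0 \<le> (\<bar>a\<bar> - \<epsilon>)\<^sup>2" by simp
    then have "2 * \<epsilon> * \<bar>a\<bar> \<le> a\<^sup>2 + \<epsilon>\<^sup>2" by (simp add: power2_diff mult_ac)
    then show ?thesis using \<epsilon> by (simp add: field_simps power2_eq_square)
  qed
  then have "(\<integral>z. \<bar>?\<xi> z\<bar> \<partial>D) \<le> (\<integral>z. (?\<xi> z)\<^sup>2 / (2 * \<epsilon>) + \<epsilon> / 2 \<partial>D)"
    using 1 2 by (intro integral_mono) auto
  also have "\<dots> = (\<integral>z. (?\<xi> z)\<^sup>2 \<partial>D) / (2 * \<epsilon>) + \<epsilon> / 2"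
    using 2 by (simp add: prob_space)
  also have "\<dots> \<le> \<epsilon>\<^sup>2 / (2 * \<epsilon>) + \<epsilon> / 2"
    using w_error \<epsilon> by (intro add_right_mono divide_right_mono) auto
  also have "\<dots> = \<epsilon>" using \<epsilon> by (simp add: power2_eq_square)
  finally show "(\<integral>z. \<bar>?\<xi> z\<bar> \<partial>D) \<le> \<epsilon>" .
qed

section \<open>Mean and exponential moment of one step\<close>

text \<open>For p = v_t and g = w - v_t this is the quantity a_t of the overview. The residual g
  lives in H and carries the norm, while p enters only through its values.\<close>

definition gradient :: "(point \<Rightarrow> real) \<Rightarrow> (point \<Rightarrow> real) \<Rightarrow> example \<Rightarrow> real" where
  "gradient g p z = (snd z - u (p (fst z))) * g (fst z)"

context
  fixes g p :: "point \<Rightarrow> real"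
  assumes g: "g \<in> H" and p [measurable]: "p \<in> borel_measurable S"
    and gp: "\<And>x. x \<in> X \<Longrightarrow> g x = w x - p x"
begin

lemma abs_g_le: "x \<in> X \<Longrightarrow> \<bar>g x\<bar> \<le> sqrt (ip g g)"
  using apply_squared_le[OF g _ K_le] by (intro real_le_rsqrt) auto

lemma g_measurable [measurable]: "g \<in> borel_measurable S"
proof -
  have "(\<lambda>x. w x - p x) \<in> borel_measurable S" by measurable
  then show ?thesis using gp by (subst measurable_cong[where g = "\<lambda>x. w x - p x"]) auto
qed

lemma abs_gradient_le: "z \<in> space D \<Longrightarrow> \<bar>gradient g p z\<bar> \<le> sqrt (ip g g)"
proof -
  assume z: "z \<in> space D"
  have "\<bar>snd z - u (p (fst z))\<bar> * \<bar>g (fst z)\<bar> \<le> 1 * sqrt (ip g g)"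
    using z space_D abs_g_le[of "fst z"] u_bounds[of "p (fst z)"] by (intro mult_mono) auto
  then show ?thesis by (simp add: gradient_def abs_mult)
qed

lemma gradient_measurable [measurable]: "gradient g p \<in> borel_measurable D"
  unfolding gradient_def[abs_def] by measurable

lemma bounded_integrable:
  "h \<in> borel_measurable S \<Longrightarrow> (\<And>x. x \<in> X \<Longrightarrow> \<bar>h x\<bar> \<le> (b::real)) \<Longrightarrow> integrable D (\<lambda>z. h (fst z))"
  by (rule integrable_const_bound[where B = b]) (use space_D in auto)

lemma surrogate_integrable:
  "integrable D (\<lambda>z. (u (f (fst z)) - u (p (fst z))) * (f (fst z) - p (fst z)))"
proof (rule bounded_integrable[where b = "1 * (M + sqrt (ip g g))"])
  fix x assume x: "x \<in> X"
  have "\<bar>f x - p x\<bar> \<le> M + sqrt (ip g g)"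
    using w_bound[OF x] abs_g_le[OF x] gp[OF x] by linarith
  moreover have "\<bar>u (f x) - u (p x)\<bar> \<le> 1" using u_bounds[of "f x"] u_bounds[of "p x"] by auto
  ultimately show "\<bar>(u (f x) - u (p x)) * (f x - p x)\<bar> \<le> 1 * (M + sqrt (ip g g))"
    unfolding abs_mult by (intro mult_mono) auto
qed measurable

text \<open>After the label is replaced by its mean, split w - p into (f - p) - (f - w). The first
  part gives the surrogate loss; the second costs at most the L1 residual, since two link values
  differ by at most 1.\<close>

lemma expectation_gradient_ge: "surrogate p - \<epsilon> \<le> expectation (gradient g p)"
proof -
  have i1: "integrable D (\<lambda>z. g (fst z) * snd z)"
  proof (rule integrable_const_bound[where B = "sqrt (ip g g) * 1"])
    have "norm (g (fst z) * snd z) \<le> sqrt (ip g g) * 1" if "z \<in> space D" for z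
      unfolding real_norm_def abs_mult
      using abs_g_le[of "fst z"] that space_D ip_nonneg[OF g] by (intro mult_mono) auto
    then show "AE z in D. norm (g (fst z) * snd z) \<le> sqrt (ip g g) * 1" by auto
  qed measurable
  have i: "integrable D (\<lambda>z. g (fst z) * u (q (fst z)))" if [measurable]: "q \<in> borel_measurable S" for q
  proof (rule bounded_integrable[where b = "sqrt (ip g g) * 1"])
    show "\<bar>g x * u (q x)\<bar> \<le> sqrt (ip g g) * 1" if "x \<in> X" for x
      unfolding abs_mult using abs_g_le[OF that] u_bounds[of "q x"] ip_nonneg[OF g] by (intro mult_mono) auto
  qed measurable
  have "expectation (gradient g p) = (\<integral>z. g (fst z) * snd z - g (fst z) * u (p (fst z)) \<partial>D)"
    by (simp add: gradient_def[abs_def] algebra_simps)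
  also have "\<dots> = (\<integral>z. g (fst z) * snd z \<partial>D) - (\<integral>z. g (fst z) * u (p (fst z)) \<partial>D)"
    by (intro Bochner_Integration.integral_diff i1 i p)
  also have "(\<integral>z. g (fst z) * snd z \<partial>D) = (\<integral>z. g (fst z) * u (f (fst z)) \<partial>D)"
    by (intro regression_integral[OF _ abs_g_le]) measurable
  also have "(\<integral>z. g (fst z) * u (f (fst z)) \<partial>D) - (\<integral>z. g (fst z) * u (p (fst z)) \<partial>D) =
    (\<integral>z. g (fst z) * u (f (fst z)) - g (fst z) * u (p (fst z)) \<partial>D)"
    by (intro Bochner_Integration.integral_diff[symmetric] i p f)
  finally have E: "expectation (gradient g p) = \<dots>" .
  have "surrogate p - \<epsilon> \<le> surrogate p - (\<integral>z. \<bar>f (fst z) - w (fst z)\<bar> \<partial>D)"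
    using residual_L1 by simp
  also have "\<dots> = (\<integral>z. (u (f (fst z)) - u (p (fst z))) * (f (fst z) - p (fst z))
      - \<bar>f (fst z) - w (fst z)\<bar> \<partial>D)"
    unfolding surrogate_def
    by (intro Bochner_Integration.integral_diff[symmetric] surrogate_integrable residual_integrable)
  also have "\<dots> \<le> (\<integral>z. g (fst z) * u (f (fst z)) - g (fst z) * u (p (fst z)) \<partial>D)"
  proof (rule integral_mono)
    fix z assume "z \<in> space D"
    then have z: "fst z \<in> X" using space_D by auto
    let ?a = "u (f (fst z)) - u (p (fst z))" and ?\<xi> = "f (fst z) - w (fst z)"
    have "?a * ?\<xi> \<le> \<bar>?a\<bar> * \<bar>?\<xi>\<bar>" by (metis abs_ge_self abs_mult)
    also have "\<dots> \<le> 1 * \<bar>?\<xi>\<bar>"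
      using u_bounds[of "f (fst z)"] u_bounds[of "p (fst z)"] by (intro mult_right_mono) auto
    finally show "?a * (f (fst z) - p (fst z)) - \<bar>?\<xi>\<bar>
        \<le> g (fst z) * u (f (fst z)) - g (fst z) * u (p (fst z))"
      unfolding gp[OF z] by (simp add: algebra_simps)
  next
    show "integrable D (\<lambda>z. (u (f (fst z)) - u (p (fst z))) * (f (fst z) - p (fst z))
      - \<bar>f (fst z) - w (fst z)\<bar>)"
      by (intro Bochner_Integration.integrable_diff surrogate_integrable residual_integrable)
    show "integrable D (\<lambda>z. g (fst z) * u (f (fst z)) - g (fst z) * u (p (fst z)))"
      by (intro Bochner_Integration.integrable_diff i f p)
  qed
  finally show ?thesis unfolding E .
qed

text \<open>Hoeffding's lemma for the negated gradient, whose range has length 2 d with d the norm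
  of g: s^2 (2 d)^2 / 8 = s^2 d^2 / 2. The mean is then replaced by its lower bound.\<close>

lemma exp_gradient_le:
  assumes s: "0 < s"
  shows "(\<integral>\<^sup>+z. ennreal (exp (- (s * gradient g p z))) \<partial>D)
    \<le> ennreal (exp (s\<^sup>2 * ip g g / 2 - s * (surrogate p - \<epsilon>)))"
proof -
  let ?d = "sqrt (ip g g)" and ?f = "\<lambda>z. - gradient g p z"
  have d: "0 \<le> ip g g" by (rule ip_nonneg[OF g])
  interpret I: interval_bounded_random_variable D ?f "- ?d" ?d
  proof unfold_locales
    show "AE z in D. ?f z \<in> {- ?d..?d}"
      by (rule AE_I2) (use abs_gradient_le in \<open>force simp: abs_le_iff\<close>)
  qed measurable
  have "(\<integral>\<^sup>+z. ennreal (exp (- (s * gradient g p z))) \<partial>D)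
    = (\<integral>\<^sup>+z. ennreal (exp (s * expectation ?f)) * ennreal (exp (s * (?f z - expectation ?f))) \<partial>D)"
    by (intro nn_integral_cong) (simp add: ennreal_mult[symmetric] exp_add[symmetric] algebra_simps)
  also have "\<dots> = ennreal (exp (s * expectation ?f)) * (\<integral>\<^sup>+z. ennreal (exp (s * (?f z - expectation ?f))) \<partial>D)"
    by (intro nn_integral_cmult) measurable
  also have "\<dots> \<le> ennreal (exp (s * expectation ?f)) * ennreal (exp (s\<^sup>2 * (?d - - ?d)\<^sup>2 / 8))"
    by (intro mult_left_mono I.Hoeffdings_lemma_nn_integral s) simp
  also have "\<dots> = ennreal (exp (s\<^sup>2 * ip g g / 2 - s * expectation (gradient g p)))"
    using d by (simp add: ennreal_mult[symmetric] exp_add[symmetric] power2_eq_square algebra_simps)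
  also have "\<dots> \<le> ennreal (exp (s\<^sup>2 * ip g g / 2 - s * (surrogate p - \<epsilon>)))"
    using s expectation_gradient_ge by (intro ennreal_leI) simp
  finally show ?thesis .
qed

end


text \<open>The second-order term of the step is at most \<eta>^2, as \<bar>y - u\<bar> \<le> 1 and
  K x x \<le> 1. The exponential moment is applied at 2 s \<eta>, and (2 s \<eta>)^2 / 2 = 2 s^2
  \<eta>^2 produces the factor 1 + 2 s \<eta>^2.\<close>

lemma exp_descend_le:
  assumes g: "g \<in> H" and p: "p \<in> borel_measurable S" and gp: "\<And>x. x \<in> X \<Longrightarrow> g x = w x - p x"
    and s: "0 < s"
  shows "(\<integral>\<^sup>+z. ennreal (exp (s * (let g' = descend g (\<eta> * (snd z - u (p (fst z)))) (fst z) in ip g' g'))) \<partial>D)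
    \<le> ennreal (exp (s * (1 + 2 * s * \<eta>\<^sup>2) * ip g g + s * (\<eta>\<^sup>2 + 2 * \<eta> * \<epsilon>) - 2 * s * \<eta> * surrogate p))"
proof -
  have [measurable]: "gradient g p \<in> borel_measurable D"
    by (rule gradient_measurable[OF g p gp])
  have "s * (let g' = descend g (\<eta> * (snd z - u (p (fst z)))) (fst z) in ip g' g')
    \<le> s * ip g g + s * \<eta>\<^sup>2 + - (2 * s * \<eta> * gradient g p z)" if "z \<in> space D" for z
  proof -
    let ?a = "snd z - u (p (fst z))"
    have z: "fst z \<in> X" "snd z \<in> {0..1}" using that space_D by auto
    have "?a\<^sup>2 \<le> 1" using z u_bounds[of "p (fst z)"] by (auto simp: abs_square_le_1)
    then have "?a\<^sup>2 * K (fst z) (fst z) \<le> 1"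
      by (metis K_le[OF z(1)] mult_left_mono mult.right_neutral order_trans zero_le_power2)
    then have "\<eta>\<^sup>2 * (?a\<^sup>2 * K (fst z) (fst z)) \<le> \<eta>\<^sup>2 * 1" by (intro mult_left_mono) auto
    then have "(let g' = descend g (\<eta> * ?a) (fst z) in ip g' g') \<le> ip g g - 2 * \<eta> * gradient g p z + \<eta>\<^sup>2"
      unfolding Let_def ip_descend[OF g z(1)] by (simp add: gradient_def power_mult_distrib mult_ac)
    from mult_left_mono[OF this, of s] s show ?thesis by (simp add: algebra_simps)
  qed
  then have "(\<integral>\<^sup>+z. ennreal (exp (s * (let g' = descend g (\<eta> * (snd z - u (p (fst z)))) (fst z) in ip g' g'))) \<partial>D)
    \<le> (\<integral>\<^sup>+z. ennreal (exp (s * ip g g + s * \<eta>\<^sup>2)) * ennreal (exp (- (2 * s * \<eta> * gradient g p z))) \<partial>D)"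
    by (intro nn_integral_mono) (simp add: ennreal_mult[symmetric] exp_add[symmetric] algebra_simps)
  also have "\<dots> = ennreal (exp (s * ip g g + s * \<eta>\<^sup>2)) * (\<integral>\<^sup>+z. ennreal (exp (- (2 * s * \<eta> * gradient g p z))) \<partial>D)"
    by (intro nn_integral_cmult) measurable
  also have "\<dots> \<le> ennreal (exp (s * ip g g + s * \<eta>\<^sup>2)) *
      ennreal (exp ((2 * s * \<eta>)\<^sup>2 * ip g g / 2 - 2 * s * \<eta> * (surrogate p - \<epsilon>)))"
    using s \<eta> by (intro mult_left_mono exp_gradient_le[OF g p gp]) auto
  also have "\<dots> = ennreal (exp (s * (1 + 2 * s * \<eta>\<^sup>2) * ip g g + s * (\<eta>\<^sup>2 + 2 * \<eta> * \<epsilon>) - 2 * s * \<eta> * surrogate p))"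
    by (simp add: ennreal_mult[symmetric] exp_add[symmetric] power2_eq_square algebra_simps)
  finally show ?thesis .
qed

section \<open>Iterates and residuals as functions of the sample\<close>

abbreviation iter :: "(nat \<Rightarrow> example) \<Rightarrow> nat \<Rightarrow> point \<Rightarrow> real" where
  "iter \<omega> t \<equiv> iterate K u \<eta> \<omega> t"

text \<open>The residual w - v_t as an element of H, where its norm makes sense;
  \<open>resid_apply\<close> links it to the values of the iterate.\<close>

primrec resid :: "(nat \<Rightarrow> example) \<Rightarrow> nat \<Rightarrow> (point \<Rightarrow> real)" where
  "resid \<omega> 0 = w"
| "resid \<omega> (Suc t) = descend (resid \<omega> t) (\<eta> * (snd (\<omega> t) - u (iter \<omega> t (fst (\<omega> t))))) (fst (\<omega> t))"

definition dist_sq :: "(nat \<Rightarrow> example) \<Rightarrow> nat \<Rightarrow> real" where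
  "dist_sq \<omega> t = ip (resid \<omega> t) (resid \<omega> t)"

text \<open>The iterate is determined by the past, which allows example t to be integrated out with
  the earlier ones fixed.\<close>

lemma iter_cong: "(\<And>i. i < t \<Longrightarrow> \<omega> i = \<omega>' i) \<Longrightarrow> iter \<omega> t x = iter \<omega>' t x"
  by (induction t arbitrary: x) auto

lemma resid_cong: "(\<And>i. i < t \<Longrightarrow> \<omega> i = \<omega>' i) \<Longrightarrow> resid \<omega> t = resid \<omega>' t"
proof (induction t)
  case (Suc t)
  then show ?case using iter_cong[of t \<omega> \<omega>'] by simp
qed simp

lemma resid_mem: "(\<And>i. i < t \<Longrightarrow> fst (\<omega> i) \<in> X) \<Longrightarrow> resid \<omega> t \<in> H"
  by (induction t) (auto intro: w_mem descend_mem)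

lemma resid_apply:
  "(\<And>i. i < t \<Longrightarrow> fst (\<omega> i) \<in> X) \<Longrightarrow> x \<in> X \<Longrightarrow> resid \<omega> t x = w x - iter \<omega> t x"
  by (induction t) (auto simp: descend_apply)

abbreviation samples :: "nat set \<Rightarrow> (nat \<Rightarrow> example) measure" where
  "samples I \<equiv> Pi\<^sub>M I (\<lambda>_. D)"

lemma sample_mem: "\<omega> \<in> space (samples I) \<Longrightarrow> i \<in> I \<Longrightarrow> fst (\<omega> i) \<in> X"
  using space_D PiE_mem[of \<omega> I "\<lambda>_. space D" i] by (auto simp: space_PiM)

lemma K_measurable' [measurable (raw)]:
  "a \<in> measurable N S \<Longrightarrow> b \<in> measurable N S \<Longrightarrow> (\<lambda>q. K (a q) (b q)) \<in> borel_measurable N"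
  using measurable_compose[OF measurable_Pair K_measurable] by simp

lemma iterate_0: "iterate K u \<eta> \<omega> 0 = (\<lambda>x. 0)"
  by (rule ext) simp

text \<open>Measurability has to be joint in sample and point, because the recursion evaluates an
  earlier iterate at a sampled point.\<close>

lemma iter_measurable_pair:
  "{..<t} \<subseteq> I \<Longrightarrow> (\<lambda>(\<omega>, x). iter \<omega> t x) \<in> borel_measurable (samples I \<Otimes>\<^sub>M S)"
proof (induction t)
  case (Suc t)
  then have t [measurable]: "t \<in> I"
    and IH: "(\<lambda>(\<omega>, x). iter \<omega> t x) \<in> borel_measurable (samples I \<Otimes>\<^sub>M S)"
    by (auto simp: lessThan_Suc)
  have z [measurable]: "(\<lambda>q. fst q t) \<in> measurable (samples I \<Otimes>\<^sub>M S) D"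
    using t by measurable
  have x [measurable]: "(\<lambda>q. fst (fst q t)) \<in> measurable (samples I \<Otimes>\<^sub>M S) S"
    using measurable_compose[OF z fst_measurable] .
  have [measurable]: "(\<lambda>q. iter (fst q) t (snd q)) \<in> borel_measurable (samples I \<Otimes>\<^sub>M S)"
    using IH by (simp add: case_prod_beta')
  have [measurable]: "(\<lambda>q. iter (fst q) t (fst (fst q t))) \<in> borel_measurable (samples I \<Otimes>\<^sub>M S)"
    using measurable_compose[OF measurable_Pair[OF measurable_fst x] IH] by simp
  show ?case unfolding case_prod_beta' iterate.simps by measurable
qed (simp add: iterate_0)

lemma iter_measurable [measurable (raw)]:
  assumes "\<And>i. i < t \<Longrightarrow> i \<in> I" "a \<in> measurable N (samples I)" "b \<in> measurable N S"
  shows "(\<lambda>q. iter (a q) t (b q)) \<in> borel_measurable N"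
  using measurable_compose[OF measurable_Pair[OF assms(2,3)] iter_measurable_pair] assms(1) by auto

lemma iter_measurable_point:
  assumes "\<And>i. i < t \<Longrightarrow> fst (\<omega> i) \<in> X"
  shows "iter \<omega> t \<in> borel_measurable S"
  using assms
proof (induction t)
  case (Suc t)
  then have [measurable]: "iter \<omega> t \<in> borel_measurable S" by simp
  have [measurable]: "(\<lambda>x. fst (\<omega> t)) \<in> measurable S S" using Suc(2) by simp
  show ?case unfolding iterate.simps by measurable
qed (simp add: iterate_0)

text \<open>Writes the squared norm through real-valued functions of the sample; its measurability
  is derived this way, as H carries no \<sigma>-algebra.\<close>

lemma dist_sq_Suc:
  assumes "\<And>i. i \<le> t \<Longrightarrow> fst (\<omega> i) \<in> X"
  defines "a \<equiv> \<eta> * (snd (\<omega> t) - u (iter \<omega> t (fst (\<omega> t))))"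
  shows "dist_sq \<omega> (Suc t) = dist_sq \<omega> t - 2 * a * (w (fst (\<omega> t)) - iter \<omega> t (fst (\<omega> t)))
    + a\<^sup>2 * K (fst (\<omega> t)) (fst (\<omega> t))"
proof -
  have 1: "fst (\<omega> t) \<in> X" "resid \<omega> t \<in> H" using assms by (auto intro: resid_mem)
  have 2: "resid \<omega> t (fst (\<omega> t)) = w (fst (\<omega> t)) - iter \<omega> t (fst (\<omega> t))"
    using assms by (intro resid_apply) auto
  show ?thesis
    unfolding dist_sq_def resid.simps a_def ip_descend[OF 1(2,1)] 2 ..
qed

lemma dist_sq_measurable:
  "{..<t} \<subseteq> I \<Longrightarrow> (\<lambda>\<omega>. dist_sq \<omega> t) \<in> borel_measurable (samples I)"
proof (induction t)
  case (Suc t)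
  then have t [measurable]: "t \<in> I" and le: "\<And>i. i < t \<Longrightarrow> i \<in> I"
    and IH [measurable]: "(\<lambda>\<omega>. dist_sq \<omega> t) \<in> borel_measurable (samples I)"
    by (auto simp: lessThan_Suc)
  have z [measurable]: "(\<lambda>\<omega>. \<omega> t) \<in> measurable (samples I) D"
    using t by measurable
  have x [measurable]: "(\<lambda>\<omega>. fst (\<omega> t)) \<in> measurable (samples I) S"
    using measurable_compose[OF z fst_measurable] .
  have [measurable]: "(\<lambda>\<omega>. iter \<omega> t (fst (\<omega> t))) \<in> borel_measurable (samples I)"
    by (rule iter_measurable[OF le measurable_ident_sets[OF refl] x, unfolded id_def])
  show ?case
    by (subst measurable_cong[OF dist_sq_Suc]) (use Suc(2) in \<open>auto intro!: sample_mem\<close>)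
qed (simp add: dist_sq_def)

lemma surrogate_measurable:
  assumes "{..<t} \<subseteq> I"
  shows "(\<lambda>\<omega>. surrogate (iter \<omega> t)) \<in> borel_measurable (samples I)"
proof -
  have le: "\<And>i. i < t \<Longrightarrow> i \<in> I" using assms by auto
  have x [measurable]: "(\<lambda>q. fst (snd q)) \<in> measurable (samples I \<Otimes>\<^sub>M D) S"
    by measurable
  have [measurable]: "(\<lambda>q. iter (fst q) t (fst (snd q))) \<in> borel_measurable (samples I \<Otimes>\<^sub>M D)"
    by (rule iter_measurable[OF le measurable_fst x])
  show ?thesis
    unfolding surrogate_def
    by (rule borel_measurable_lebesgue_integral) (unfold case_prod_beta', measurable)
qed

section \<open>The exponential supermartingale\<close>

text \<open>
  Hoeffding's lemma costs a factor \<open>1 + 2 s \<eta>\<^sup>2\<close> in front of the squared distance; the weights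
  \<open>s\<close> decrease from \<open>2 \<sigma>\<close> to \<open>\<sigma>\<close> just fast enough to absorb it.
\<close>

definition weight :: "nat \<Rightarrow> nat \<Rightarrow> real" where
  "weight T t = (2 - real t / real T) / (8 * \<eta>\<^sup>2 * real T)"

text \<open>Exponentiated, this is a supermartingale up to a constant factor per step. All surrogate
  terms carry the smallest weight, so the gain of the step in which a term arises always covers
  it.\<close>

definition potential :: "nat \<Rightarrow> nat \<Rightarrow> (nat \<Rightarrow> example) \<Rightarrow> real" where
  "potential T t \<omega> = weight T t * dist_sq \<omega> t
    + 2 * \<eta> * weight T T * (\<Sum>i<t. surrogate (iter \<omega> i))"

lemma weight_bounds:
  assumes "t \<le> T" "0 < T"
  shows "weight T T \<le> weight T t" "weight T t \<le> 2 * weight T T" "0 < weight T t"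
proof -
  define c where "c = 1 / (8 * \<eta>\<^sup>2 * real T)"
  have c: "0 < c" using assms \<eta> by (simp add: c_def)
  have w: "weight T t = c * (2 - real t / real T)" "weight T T = c * 1"
    using assms by (auto simp: weight_def c_def)
  have r: "real t / real T \<le> 1" "0 \<le> real t / real T" using assms by auto
  show "weight T T \<le> weight T t" unfolding w using c r by (intro mult_left_mono) auto
  have "c * (2 - real t / real T) \<le> c * 2" using c r by (intro mult_left_mono) auto
  then show "weight T t \<le> 2 * weight T T" unfolding w by simp
  show "0 < weight T t" unfolding w using c r by (intro mult_pos_pos) auto
qed

text \<open>With \<sigma> = \<open>weight T T\<close>, s \<le> 2 \<sigma> gives 2 \<eta>^2 s^2 \<le>
  8 \<eta>^2 \<sigma>^2 = 1 / (8 \<eta>^2 T^2), which is exactly the decrease of the weight in one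
  step.\<close>

lemma weight_Suc:
  assumes "t < T"
  shows "weight T (Suc t) * (1 + 2 * weight T (Suc t) * \<eta>\<^sup>2) \<le> weight T t"
proof -
  let ?s = "weight T (Suc t)"
  have T: "0 < real T" using assms by simp
  have le: "?s \<le> 2 * weight T T" "0 < ?s" using weight_bounds[of "Suc t" T] assms by auto
  have \<sigma>: "weight T T = 1 / (8 * \<eta>\<^sup>2 * real T)" using T by (simp add: weight_def)
  have "2 * \<eta>\<^sup>2 * (?s * ?s) \<le> 2 * \<eta>\<^sup>2 * ((2 * weight T T) * (2 * weight T T))"
    using le by (intro mult_left_mono mult_mono) auto
  also have "\<dots> = 1 / (8 * \<eta>\<^sup>2 * real T) / real T"
    unfolding \<sigma> using T \<eta> by (simp add: field_simps)
  also have "\<dots> = weight T t - ?s"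
    using T by (simp add: weight_def diff_divide_distrib[symmetric])
  finally show ?thesis by (simp add: algebra_simps)
qed

lemma potential_measurable:
  assumes "{..<t} \<subseteq> I"
  shows "potential T t \<in> borel_measurable (samples I)"
proof -
  have [measurable]: "(\<lambda>\<omega>. dist_sq \<omega> t) \<in> borel_measurable (samples I)"
    by (rule dist_sq_measurable[OF assms])
  have [measurable]: "(\<lambda>\<omega>. surrogate (iter \<omega> i)) \<in> borel_measurable (samples I)" if "i < t" for i
    by (rule surrogate_measurable) (use assms that in auto)
  have "(\<lambda>\<omega>. weight T t * dist_sq \<omega> t
    + 2 * \<eta> * weight T T * (\<Sum>i<t. surrogate (iter \<omega> i))) \<in> borel_measurable (samples I)"
    by measurable
  then show ?thesis by (simp add: potential_def[abs_def])
qed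

text \<open>With the past fixed, only the new squared distance depends on the fresh example: the
  surrogate sum up to index t is already determined. Hence \<open>exp_descend_le\<close> applies
  with s the next weight.\<close>

lemma potential_step:
  assumes t: "t < T" and zs: "zs \<in> space (samples {..<t})"
  shows "(\<integral>\<^sup>+z. ennreal (exp (potential T (Suc t) (zs(t := z)))) \<partial>D)
    \<le> ennreal (exp (2 * weight T T * (\<eta>\<^sup>2 + 2 * \<eta> * \<epsilon>))) * ennreal (exp (potential T t zs))"
proof -
  let ?s = "weight T (Suc t)" and ?\<sigma> = "weight T T"
  define A where "A = (\<Sum>i<Suc t. surrogate (iter zs i))"
  have X: "fst (zs i) \<in> X" if "i < t" for i
    using sample_mem[OF zs] that by auto
  have it: "iter (zs(t := z)) i = iter zs i" if "i \<le> t" for i z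
    using that by (intro ext iter_cong) auto
  have re: "resid (zs(t := z)) t = resid zs t" for z
    by (intro resid_cong) auto
  have s: "?\<sigma> \<le> ?s" "?s \<le> 2 * ?\<sigma>" "0 < ?s" "0 < ?\<sigma>"
    using weight_bounds[of "Suc t" T] weight_bounds[of T T] t by auto
  have sum: "(\<Sum>i<Suc t. surrogate (iter (zs(t := z)) i)) = A" for z
    unfolding A_def by (intro sum.cong) (auto simp: it)
  define Q where "Q z = ?s * (let g' = descend (resid zs t)
      (\<eta> * (snd z - u (iter zs t (fst z)))) (fst z) in ip g' g')" for z
  have pot: "potential T (Suc t) (zs(t := z)) = Q z + 2 * \<eta> * ?\<sigma> * A" for z
    unfolding potential_def sum dist_sq_def by (simp add: re it Let_def Q_def)
  have iter_m [measurable]: "iter zs t \<in> borel_measurable S" by (rule iter_measurable_point[OF X])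
  \<comment> \<open>Measurability is checked on the expanded quadratic, which agrees with
    \<open>Q\<close> on the space of D.\<close>
  have "(\<lambda>z. ?s * (ip (resid zs t) (resid zs t) - 2 * (\<eta> * (snd z - u (iter zs t (fst z)))) * (w (fst z) - iter zs t (fst z))
        + (\<eta> * (snd z - u (iter zs t (fst z))))\<^sup>2 * K (fst z) (fst z))) \<in> borel_measurable D"
    by measurable
  moreover have "ip (descend (resid zs t) (\<eta> * (snd z - u (iter zs t (fst z)))) (fst z))
      (descend (resid zs t) (\<eta> * (snd z - u (iter zs t (fst z)))) (fst z)) =
     (ip (resid zs t) (resid zs t) - 2 * (\<eta> * (snd z - u (iter zs t (fst z)))) * (w (fst z) - iter zs t (fst z))
        + (\<eta> * (snd z - u (iter zs t (fst z))))\<^sup>2 * K (fst z) (fst z))" if "z \<in> space D" for z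
  proof -
    have z: "fst z \<in> X" using that space_D by auto
    have 1: "resid zs t \<in> H" by (intro resid_mem X)
    have 2: "resid zs t (fst z) = w (fst z) - iter zs t (fst z)" by (intro resid_apply X z)
    show ?thesis unfolding ip_descend[OF 1 z] 2 ..
  qed
  ultimately have [measurable]: "Q \<in> borel_measurable D"
    unfolding Q_def Let_def by (subst measurable_cong) auto
  have "(\<integral>\<^sup>+z. ennreal (exp (potential T (Suc t) (zs(t := z)))) \<partial>D) =
    (\<integral>\<^sup>+z. ennreal (exp (2 * \<eta> * ?\<sigma> * A)) * ennreal (exp (Q z)) \<partial>D)"
    unfolding pot by (intro nn_integral_cong) (simp add: ennreal_mult[symmetric] exp_add[symmetric] add.commute)
  also have "\<dots> = ennreal (exp (2 * \<eta> * ?\<sigma> * A)) * (\<integral>\<^sup>+z. ennreal (exp (Q z)) \<partial>D)"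
    by (intro nn_integral_cmult) measurable
  also have "\<dots> \<le> ennreal (exp (2 * \<eta> * ?\<sigma> * A)) *
      ennreal (exp (?s * (1 + 2 * ?s * \<eta>\<^sup>2) * dist_sq zs t + ?s * (\<eta>\<^sup>2 + 2 * \<eta> * \<epsilon>)
        - 2 * ?s * \<eta> * surrogate (iter zs t)))"
    unfolding dist_sq_def Q_def
    by (intro mult_left_mono exp_descend_le resid_mem resid_apply iter_m X s) auto
  also have "\<dots> = ennreal (exp (2 * \<eta> * ?\<sigma> * A + (?s * (1 + 2 * ?s * \<eta>\<^sup>2) * dist_sq zs t
      + ?s * (\<eta>\<^sup>2 + 2 * \<eta> * \<epsilon>) - 2 * ?s * \<eta> * surrogate (iter zs t))))"
    by (simp add: ennreal_mult[symmetric] exp_add[symmetric])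
  also have "\<dots> \<le> ennreal (exp (2 * ?\<sigma> * (\<eta>\<^sup>2 + 2 * \<eta> * \<epsilon>) + potential T t zs))"
  proof -
    \<comment> \<open>The three terms use three facts on weights: the decrease absorbs the distance
      factor, s \<le> 2 \<sigma> bounds the constant, and s \<ge> \<sigma> makes the gain cover the
      new surrogate term.\<close>
    have "?s * (1 + 2 * ?s * \<eta>\<^sup>2) * dist_sq zs t \<le> weight T t * dist_sq zs t"
      unfolding dist_sq_def by (intro mult_right_mono weight_Suc t ip_nonneg resid_mem X)
    moreover have "?s * (\<eta>\<^sup>2 + 2 * \<eta> * \<epsilon>) \<le> 2 * ?\<sigma> * (\<eta>\<^sup>2 + 2 * \<eta> * \<epsilon>)"
      using s \<eta> \<epsilon> by (intro mult_right_mono) auto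
    moreover have "?\<sigma> * (2 * \<eta> * surrogate (iter zs t)) \<le> ?s * (2 * \<eta> * surrogate (iter zs t))"
      using s \<eta> surrogate_nonneg by (intro mult_right_mono) auto
    ultimately show ?thesis
      unfolding potential_def A_def by (intro ennreal_leI) (simp add: algebra_simps)
  qed
  finally show ?thesis by (simp add: ennreal_mult[symmetric] exp_add[symmetric])
qed

text \<open>The last example is integrated out first, so each step contributes one constant
  factor.\<close>

lemma potential_mgf:
  "t \<le> T \<Longrightarrow> (\<integral>\<^sup>+zs. ennreal (exp (potential T t zs)) \<partial>samples {..<t})
    \<le> ennreal (exp (weight T 0 * ip w w + t * (2 * weight T T * (\<eta>\<^sup>2 + 2 * \<eta> * \<epsilon>))))"
proof (induction t)
  case 0
  interpret P: product_sigma_finite "\<lambda>_::nat. D"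
    by (intro product_sigma_finite.intro sigma_finite_measure_axioms)
  interpret Q: prob_space "samples {}" by (intro prob_space_PiM prob_space_axioms)
  show ?case
    by (simp add: potential_def dist_sq_def Q.emeasure_space_1)
next
  case (Suc t)
  interpret P: product_sigma_finite "\<lambda>_::nat. D"
    by (intro product_sigma_finite.intro sigma_finite_measure_axioms)
  let ?c = "2 * weight T T * (\<eta>\<^sup>2 + 2 * \<eta> * \<epsilon>)"
  have [measurable]: "potential T t \<in> borel_measurable (samples {..<t})"
    "potential T (Suc t) \<in> borel_measurable (samples (insert t {..<t}))"
    by (auto intro!: potential_measurable simp: lessThan_Suc)
  have "(\<integral>\<^sup>+zs. ennreal (exp (potential T (Suc t) zs)) \<partial>samples {..<Suc t}) =
    (\<integral>\<^sup>+zs. (\<integral>\<^sup>+z. ennreal (exp (potential T (Suc t) (zs(t := z)))) \<partial>D) \<partial>samples {..<t})"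
    unfolding lessThan_Suc by (rule P.product_nn_integral_insert) (simp, simp, measurable)
  also have "\<dots> \<le> (\<integral>\<^sup>+zs. ennreal (exp ?c) * ennreal (exp (potential T t zs)) \<partial>samples {..<t})"
    using Suc(2) by (intro nn_integral_mono potential_step) auto
  also have "\<dots> = ennreal (exp ?c) * (\<integral>\<^sup>+zs. ennreal (exp (potential T t zs)) \<partial>samples {..<t})"
    by (intro nn_integral_cmult) measurable
  also have "\<dots> \<le> ennreal (exp ?c) * ennreal (exp (weight T 0 * ip w w + t * ?c))"
    using Suc by (intro mult_left_mono) auto
  finally show ?case by (simp add: ennreal_mult[symmetric] exp_add[symmetric] algebra_simps)
qed

lemma surrogate_average_bound:
  assumes T: "0 < T" and \<delta>: "0 < \<delta>" "\<delta> < 1"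
  shows "1 - \<delta> \<le> measure (samples {..<T}) {\<omega> \<in> space (samples {..<T}).
    (\<Sum>i<T. surrogate (iter \<omega> i)) / T \<le> ip w w / (\<eta> * T) + \<eta> + 2 * \<epsilon> + 4 * \<eta> * ln (1 / \<delta>)}"
    (is "_ \<le> measure ?P ?G")
proof -
  interpret P: prob_space ?P by (intro prob_space_PiM prob_space_axioms)
  define c where "c = weight T 0 * ip w w + T * (2 * weight T T * (\<eta>\<^sup>2 + 2 * \<eta> * \<epsilon>))"
  have pot [measurable]: "potential T T \<in> borel_measurable ?P"
    by (rule potential_measurable) simp
  have [measurable]: "(\<lambda>\<omega>. surrogate (iter \<omega> i)) \<in> borel_measurable ?P" if "i < T" for i
    by (rule surrogate_measurable) (use that in auto)
  have G [measurable]: "?G \<in> sets ?P" by measurable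
  \<comment> \<open>The event that the exponentiated potential reaches exp c / \<delta>, written as
    Markov's inequality expects it.\<close>
  let ?B = "{\<omega> \<in> space ?P. 1 \<le> ennreal (\<delta> / exp c) * ennreal (exp (potential T T \<omega>))}"
  have "emeasure ?P ?B \<le> ennreal (\<delta> / exp c) * (\<integral>\<^sup>+\<omega>. ennreal (exp (potential T T \<omega>)) * indicator (space ?P) \<omega> \<partial>?P)"
    by (intro nn_integral_Markov_inequality) measurable
  also have "\<dots> = ennreal (\<delta> / exp c) * (\<integral>\<^sup>+\<omega>. ennreal (exp (potential T T \<omega>)) \<partial>?P)"
    by (intro arg_cong2[where f = "(*)"] refl nn_integral_cong) simp
  also have "\<dots> \<le> ennreal (\<delta> / exp c) * ennreal (exp c)"
    unfolding c_def by (intro mult_left_mono potential_mgf) auto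
  also have "\<dots> = ennreal \<delta>" using \<delta> by (simp add: ennreal_mult[symmetric])
  finally have "measure ?P ?B \<le> \<delta>"
    using \<delta> by (simp add: P.emeasure_eq_measure)
  moreover have "space ?P - ?G \<subseteq> ?B"
  proof
    fix \<omega> assume \<omega>: "\<omega> \<in> space ?P - ?G"
    define \<Sigma> where "\<Sigma> = (\<Sum>i<T. surrogate (iter \<omega> i))"
    have le: "ip w w / (\<eta> * T) + \<eta> + 2 * \<epsilon> + 4 * \<eta> * ln (1 / \<delta>) \<le> \<Sigma> / T"
      using \<omega> by (auto simp: \<Sigma>_def)
    have w: "weight T T = 1 / (8 * \<eta>\<^sup>2 * T)" "weight T 0 = 2 / (8 * \<eta>\<^sup>2 * T)"
      using T by (auto simp: weight_def)
    \<comment> \<open>Since 2 \<eta> * \<open>weight T T\<close> = 1 / (4 \<eta> T), this scaling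
      turns the average into its term in the potential, and the threshold into c + ln (1 /
      \<delta>).\<close>
    have "(1 / (4 * \<eta>)) * (ip w w / (\<eta> * T) + \<eta> + 2 * \<epsilon> + 4 * \<eta> * ln (1 / \<delta>)) \<le> (1 / (4 * \<eta>)) * (\<Sigma> / T)"
      using le \<eta> by (intro mult_left_mono) auto
    moreover have "(1 / (4 * \<eta>)) * (ip w w / (\<eta> * T) + \<eta> + 2 * \<epsilon> + 4 * \<eta> * ln (1 / \<delta>)) = c + ln (1 / \<delta>)"
      unfolding c_def w using T \<eta> by (simp add: field_simps power2_eq_square)
    moreover have "(1 / (4 * \<eta>)) * (\<Sigma> / T) = 2 * \<eta> * weight T T * \<Sigma>"
      unfolding w using T \<eta> by (simp add: field_simps power2_eq_square)
    moreover have "0 \<le> weight T T * dist_sq \<omega> T"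
      using \<omega> sample_mem[of \<omega> "{..<T}"] weight_bounds(3)[of T T] T unfolding dist_sq_def
      by (intro mult_nonneg_nonneg ip_nonneg resid_mem) auto
    ultimately have "c + ln (1 / \<delta>) \<le> potential T T \<omega>"
      unfolding potential_def \<Sigma>_def by linarith
    then have "exp c * (1 / \<delta>) \<le> exp (potential T T \<omega>)"
      using \<delta> by (metis exp_add exp_le_cancel_iff exp_ln zero_less_divide_1_iff)
    then have "1 \<le> \<delta> / exp c * exp (potential T T \<omega>)"
      using \<delta> by (simp add: field_simps)
    then show "\<omega> \<in> ?B" using \<omega> \<delta> by (simp add: ennreal_mult[symmetric])
  qed
  then have "measure ?P (space ?P - ?G) \<le> measure ?P ?B"
    by (intro P.finite_measure_mono) measurable
  ultimately show ?thesis
    using P.prob_compl[OF G] by simp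
qed

section \<open>Risk of the averaged hypothesis\<close>

lemma risk_averaged_le:
  assumes \<omega>: "\<omega> \<in> space (samples {..<T})" and T: "0 < T"
  shows "risk n X D (averaged K u \<eta> T \<omega>) \<le> L * ((\<Sum>i<T. surrogate (iter \<omega> i)) / T)"
proof -
  have X: "fst (\<omega> i) \<in> X" if "i < T" for i
    using sample_mem[OF \<omega>] that by auto
  have m [measurable]: "iter \<omega> i \<in> borel_measurable S" if "i < T" for i
    using that X by (intro iter_measurable_point) auto
  have avm [measurable]: "averaged K u \<eta> T \<omega> \<in> borel_measurable S"
    unfolding averaged_def[abs_def] by measurable
  let ?I = "\<lambda>i z. (u (f (fst z)) - u (iter \<omega> i (fst z))) * (f (fst z) - iter \<omega> i (fst z))"
  have int: "integrable D (?I i)" if "i < T" for i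
    using that X m by (intro surrogate_integrable[OF resid_mem _ resid_apply]) auto
  have "risk n X D (averaged K u \<eta> T \<omega>) = (\<integral>z. (averaged K u \<eta> T \<omega> (fst z) - u (f (fst z)))\<^sup>2 \<partial>D)"
    unfolding risk_def by (rule integral_cong_AE) (use regression in auto)
  also have "\<dots> \<le> (\<integral>z. (\<Sum>i<T. L * ?I i z) / T \<partial>D)"
  proof (rule integral_mono')
    fix z
    let ?v = "u (f (fst z))"
    \<comment> \<open>The factor 1 is written out for Cauchy-Schwarz against the all-ones vector,
      which gives convexity of the square.\<close>
    have "(averaged K u \<eta> T \<omega> (fst z) - ?v)\<^sup>2 = (\<Sum>i<T. (u (iter \<omega> i (fst z)) - ?v) * 1)\<^sup>2 / (real T)\<^sup>2"
    proof -
      have "averaged K u \<eta> T \<omega> (fst z) - ?v = (\<Sum>i<T. (u (iter \<omega> i (fst z)) - ?v) * 1) / real T"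
        using T by (simp add: averaged_def sum_subtractf diff_divide_distrib)
      then show ?thesis by (simp only: power_divide)
    qed
    also have "\<dots> \<le> ((\<Sum>i<T. (u (iter \<omega> i (fst z)) - ?v)\<^sup>2) * (\<Sum>i<T. 1\<^sup>2)) / (real T)\<^sup>2"
      by (intro divide_right_mono Cauchy_Schwarz_ineq_sum) auto
    also have "\<dots> = (\<Sum>i<T. (?v - u (iter \<omega> i (fst z)))\<^sup>2) / T"
      using T by (simp add: power2_eq_square[of "real T"] power2_commute)
    also have "\<dots> \<le> (\<Sum>i<T. L * ?I i z) / T"
      by (intro divide_right_mono sum_mono u_square_le) auto
    finally show "(averaged K u \<eta> T \<omega> (fst z) - ?v)\<^sup>2 \<le> (\<Sum>i<T. L * ?I i z) / T" .
    show "0 \<le> (\<Sum>i<T. L * ?I i z) / T" if "z \<in> space D" for z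
      by (intro divide_nonneg_nonneg sum_nonneg mult_nonneg_nonneg[OF L_nonneg] u_mult_nonneg) auto
    show "integrable D (\<lambda>z. (\<Sum>i<T. L * ?I i z) / T)"
      by (intro integrable_divide_zero integrable_sum integrable_mult_right) (use int in auto)
  qed
  also have "\<dots> = L * ((\<Sum>i<T. surrogate (iter \<omega> i)) / T)"
    unfolding surrogate_def using int by (simp add: sum_distrib_left)
  finally show ?thesis .
qed

lemma risk_measurable: "(\<lambda>\<omega>. risk n X D (averaged K u \<eta> T \<omega>)) \<in> borel_measurable (samples {..<T})"
proof -
  have x [measurable]: "(\<lambda>q. fst (snd q)) \<in> measurable (samples {..<T} \<Otimes>\<^sub>M D) S"
    by measurable
  have [measurable]: "(\<lambda>q. iter (fst q) t (fst (snd q))) \<in> borel_measurable (samples {..<T} \<Otimes>\<^sub>M D)"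
    if "t < T" for t
    by (rule iter_measurable[OF _ measurable_fst x]) (use that in auto)
  show ?thesis
    unfolding risk_def averaged_def
    by (rule borel_measurable_lebesgue_integral) (unfold case_prod_beta', measurable)
qed

lemma averaged_measurable:
  assumes "\<omega> \<in> space (samples {..<T})"
  shows "averaged K u \<eta> T \<omega> \<in> borel_measurable S"
proof -
  have [measurable]: "iter \<omega> i \<in> borel_measurable S" if "i < T" for i
    using that sample_mem[OF assms] by (intro iter_measurable_point) auto
  show ?thesis unfolding averaged_def[abs_def] by measurable
qed

text \<open>Covers the empty sample. As u has values in [0, 1], the square is at most \<bar>u 0 - u
  (f x)\<bar> \<le> L \<bar>f x\<bar>, and \<bar>f x\<bar> is at most the residual plus the norm of
  w.\<close>

lemma risk_constant_le: "risk n X D (averaged K u \<eta> 0 \<omega>) \<le> L * (\<epsilon> + sqrt (ip w w))"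
proof -
  have "risk n X D (averaged K u \<eta> 0 \<omega>) = (\<integral>z. (u 0 - u (f (fst z)))\<^sup>2 \<partial>D)"
    unfolding risk_def averaged_def by (simp, rule integral_cong_AE) (use regression in auto)
  also have "\<dots> \<le> (\<integral>z. L * (\<bar>f (fst z) - w (fst z)\<bar> + sqrt (ip w w)) \<partial>D)"
  proof (rule integral_mono_AE')
    have "(u 0 - u (f (fst z)))\<^sup>2 \<le> L * (\<bar>f (fst z) - w (fst z)\<bar> + sqrt (ip w w))"
      if "z \<in> space D" for z
    proof -
      have z: "fst z \<in> X" using that space_D by auto
      have "\<bar>w (fst z)\<bar> \<le> sqrt (ip w w)"
        using apply_squared_le[OF w_mem z K_le[OF z]] by (intro real_le_rsqrt) auto
      then have f: "\<bar>f (fst z)\<bar> \<le> \<bar>f (fst z) - w (fst z)\<bar> + sqrt (ip w w)" by linarith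
      have "(u 0 - u (f (fst z)))\<^sup>2 = \<bar>u 0 - u (f (fst z))\<bar> * \<bar>u 0 - u (f (fst z))\<bar>"
        by (simp add: power2_eq_square)
      also have "\<dots> \<le> 1 * \<bar>u 0 - u (f (fst z))\<bar>"
        using u_bounds[of 0] u_bounds[of "f (fst z)"] by (intro mult_right_mono) auto
      also have "\<dots> \<le> L * \<bar>f (fst z)\<bar>" using u_lipschitz[of 0 "f (fst z)"] by simp
      also have "\<dots> \<le> L * (\<bar>f (fst z) - w (fst z)\<bar> + sqrt (ip w w))"
        by (intro mult_left_mono f L_nonneg)
      finally show ?thesis .
    qed
    then show "AE z in D. (u 0 - u (f (fst z)))\<^sup>2 \<le> L * (\<bar>f (fst z) - w (fst z)\<bar> + sqrt (ip w w))"
      by auto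
  qed (use residual_integrable L_nonneg ip_nonneg[OF w_mem] in auto)
  also have "\<dots> = L * ((\<integral>z. \<bar>f (fst z) - w (fst z)\<bar> \<partial>D) + sqrt (ip w w))"
    using residual_integrable by (simp add: prob_space)
  also have "\<dots> \<le> L * (\<epsilon> + sqrt (ip w w))"
    by (intro mult_left_mono add_right_mono residual_L1 L_nonneg)
  finally show ?thesis .
qed

end

section \<open>Resources and risk of the algorithm\<close>

text \<open>Makes the asymptotic bound uniform: the finitely many exceptional values are added to
  the constant, and 1 + n keeps the power at least 1 at n = 0.\<close>

lemma poly_boundedE:
  assumes "poly_bounded c"
  obtains a k where "0 \<le> a" "\<And>n. real (c n) \<le> a * (1 + real n) ^ k"
proof -
  obtain k where "(\<lambda>n. real (c n)) \<in> O(\<lambda>n. real n ^ k)"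
    using assms unfolding poly_bounded_def by blast
  then obtain b where b: "eventually (\<lambda>n. norm (real (c n)) \<le> b * norm (real n ^ k)) at_top"
    unfolding bigo_def by auto
  then obtain N where N: "\<And>n. n \<ge> N \<Longrightarrow> real (c n) \<le> b * real n ^ k"
    by (auto simp: eventually_sequentially)
  define a where "a = max 0 b + (\<Sum>i<N. real (c i))"
  show ?thesis
  proof
    show "0 \<le> a" unfolding a_def by (intro add_nonneg_nonneg sum_nonneg) auto
    fix n
    have p: "1 \<le> (1 + real n) ^ k" by simp
    show "real (c n) \<le> a * (1 + real n) ^ k"
    proof (cases "N \<le> n")
      case True
      have "real (c n) \<le> b * real n ^ k" by (rule N[OF True])
      also have "\<dots> \<le> max 0 b * (1 + real n) ^ k" by (intro mult_mono power_mono) auto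
      also have "\<dots> \<le> a * (1 + real n) ^ k"
        unfolding a_def using p by (intro mult_right_mono) (auto intro!: sum_nonneg)
      finally show ?thesis .
    next
      case False
      then have "real (c n) \<le> (\<Sum>i<N. real (c i))"
        by (intro member_le_sum) auto
      also have "\<dots> \<le> a" unfolding a_def by simp
      also have "\<dots> \<le> a * (1 + real n) ^ k"
        using p \<open>0 \<le> a\<close> mult_left_mono[of 1 "(1 + real n) ^ k" a] by simp
      finally show ?thesis .
    qed
  qed
qed

lemma sample_size_le:
  assumes "0 < \<epsilon>"
  shows "real (sample_size B \<epsilon> \<delta>) \<le> B\<^sup>2 * real (doublings \<delta>) / \<epsilon>\<^sup>2"
proof -
  have "0 \<le> \<lfloor>B\<^sup>2 * real (doublings \<delta>) / \<epsilon>\<^sup>2\<rfloor>" by simp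
  then show ?thesis unfolding sample_size_def by linarith
qed

lemma outputs_averaged:
  assumes E: "E = \<lparr>dimension = n, kernel = K, kernel_cost = \<kappa>, link = u, examples = \<omega>\<rparr>"
    and par: "0 < \<epsilon>" "0 < \<delta>" "\<delta> < 1"
    and X: "X \<subseteq> extensional {..<n}"
    and \<omega>: "\<And>i. i < sample_size B \<epsilon> \<delta> \<Longrightarrow> fst (\<omega> i) \<in> X"
    and \<tau>: "real (20 * doublings \<delta> + (sample_size B \<epsilon> \<delta> + 2)\<^sup>2 * (100 + n + \<kappa>)) \<le> \<tau>"
  shows "outputs_hypothesis train_prog predict_prog E [B, M, L, \<epsilon>, \<delta>] X (sample_size B \<epsilon> \<delta>) \<tau>
    (averaged K u (rate \<epsilon> \<delta>) (sample_size B \<epsilon> \<delta>) \<omega>)"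
proof -
  define T where "T = sample_size B \<epsilon> \<delta>"
  define \<eta> where "\<eta> = rate \<epsilon> \<delta>"
  have fields: "dimension E = n" "kernel E = K" "kernel_cost E = \<kappa>" "link E = u" "examples E = \<omega>"
    unfolding E by auto
  have "runs E train_prog (initial_state n [B, M, L, \<epsilon>, \<delta>])
    (\<lambda>\<tau> s. \<tau> \<le> 20 * doublings \<delta> + (T + 2)\<^sup>2 * (100 + n + \<kappa>) \<and> drawn s = T \<and>
      stored n (\<lambda>i. fst (\<omega> i)) (step_coeff K u \<eta> \<omega>) T (mem s) \<and>
      nreg s 0 = T * (n + 1) \<and> nreg s 1 = n \<and> rreg s 6 = T)"
    by (rule runs_train[OF fields par T_def \<eta>_def]) (use X \<omega> T_def in auto)
  then obtain t s where t: "exec E train_prog (initial_state n [B, M, L, \<epsilon>, \<delta>]) t s"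
      "t \<le> 20 * doublings \<delta> + (T + 2)\<^sup>2 * (100 + n + \<kappa>)"
    and s: "drawn s = T" "stored n (\<lambda>i. fst (\<omega> i)) (step_coeff K u \<eta> \<omega>) T (mem s)"
      "nreg s 0 = T * (n + 1)" "nreg s 1 = n" "rreg s 6 = T"
    unfolding runs_def by blast
  have p: "\<exists>t' s'. exec E predict_prog (s\<lparr>mem := write_point n (nreg s 0) x (mem s)\<rparr>) t' s' \<and>
        real t' \<le> \<tau> \<and> drawn s' = T \<and> rreg s' 0 = averaged K u \<eta> T \<omega> x" if x: "x \<in> X" for x
  proof -
    let ?s = "s\<lparr>mem := write_point n (nreg s 0) x (mem s)\<rparr>"
    have "stored n (\<lambda>i. fst (\<omega> i)) (step_coeff K u \<eta> \<omega>) T (mem ?s)"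
      by (rule stored_cong[OF s(2)]) (simp add: s write_point_def)
    moreover have "read_point n (T * (n + 1)) (mem ?s) = x"
      using X x s by (auto simp: read_write_point)
    ultimately have "runs E predict_prog ?s (\<lambda>\<tau> s'. \<tau> \<le> (T + 2) * (40 + \<kappa>) \<and> drawn s' = drawn ?s \<and>
        rreg s' 0 = averaged K u \<eta> T \<omega> x)"
      by (rule runs_predict[OF fields(1-4)]) (use s in auto)
    moreover have "(T + 2) * (40 + \<kappa>) \<le> 20 * doublings \<delta> + (T + 2)\<^sup>2 * (100 + n + \<kappa>)"
      by (simp add: power2_eq_square algebra_simps)
    then have "real t' \<le> \<tau>" if "t' \<le> (T + 2) * (40 + \<kappa>)" for t'
      using that \<tau> unfolding T_def by linarith
    ultimately show ?thesis unfolding runs_def using s(1) by auto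
  qed
  have "real t \<le> \<tau>" using t(2) \<tau> unfolding T_def by linarith
  then show ?thesis
    unfolding outputs_hypothesis_def fields(1) T_def[symmetric] \<eta>_def[symmetric]
    using t(1) s(1) p by (intro exI[of _ t] exI[of _ s]) simp
qed

text \<open>The base s is at least 1 and dominates every parameter. So T + 2 \<le> 4 s^5, whose
  square times (101 + c) s^(1 + k) gives 1616 + 16 c and exponent 11 + k; the doublings add
  40.\<close>

lemma training_time_le:
  assumes \<epsilon>: "0 < \<epsilon>" and \<delta>: "0 < \<delta>" "\<delta> < 1" and nonneg: "0 \<le> B" "0 \<le> M" "0 \<le> L"
    and \<kappa>: "real \<kappa> \<le> c * (1 + real n) ^ k" "0 \<le> c"
  shows "real (20 * doublings \<delta> + (sample_size B \<epsilon> \<delta> + 2)\<^sup>2 * (100 + n + \<kappa>))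
    \<le> (1656 + 16 * c) * (1 + real n + B + M + L + 1 / \<epsilon> + ln (1 / \<delta>)) ^ (11 + k)"
proof -
  define s where "s = 1 + real n + B + M + L + 1 / \<epsilon> + ln (1 / \<delta>)"
  have ln: "0 \<le> ln (1 / \<delta>)" using \<delta> by simp
  have \<epsilon>': "0 \<le> 1 / \<epsilon>" using \<epsilon> by simp
  have s: "1 \<le> s" "1 + real n \<le> s" "B \<le> s" "1 / \<epsilon> \<le> s" "1 + ln (1 / \<delta>) \<le> s"
    unfolding s_def using ln \<epsilon>' nonneg by linarith+
  have j: "real (doublings \<delta>) \<le> 2 * s" using doublings(5)[OF \<delta>] s(5) by linarith
  have "real (sample_size B \<epsilon> \<delta>) \<le> B\<^sup>2 * real (doublings \<delta>) / \<epsilon>\<^sup>2" by (rule sample_size_le[OF \<epsilon>])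
  also have "\<dots> = B\<^sup>2 * (1 / \<epsilon>)\<^sup>2 * real (doublings \<delta>)" by (simp add: power_divide)
  also have "\<dots> \<le> s\<^sup>2 * s\<^sup>2 * (2 * s)"
    using s nonneg \<epsilon>' j by (intro mult_mono power_mono mult_nonneg_nonneg) auto
  also have "\<dots> = 2 * s ^ 5" by (simp add: power2_eq_square eval_nat_numeral)
  finally have T: "real (sample_size B \<epsilon> \<delta>) + 2 \<le> 4 * s ^ 5"
    using one_le_power[OF s(1), of 5] by linarith
  have "100 + real n + real \<kappa> \<le> 101 * s ^ (1 + k) + c * s ^ (1 + k)"
  proof -
    have "100 + real n \<le> 101 * s ^ 1" using s by simp
    also have "\<dots> \<le> 101 * s ^ (1 + k)" by (intro mult_left_mono power_increasing s) auto
    finally have "100 + real n \<le> 101 * s ^ (1 + k)" .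
    moreover have "c * (1 + real n) ^ k \<le> c * s ^ k" using s \<kappa> by (intro mult_left_mono power_mono) auto
    moreover have "c * s ^ k \<le> c * s ^ (1 + k)" using \<kappa> by (intro mult_left_mono power_increasing s) auto
    ultimately show ?thesis using \<kappa> by linarith
  qed
  then have n: "100 + real n + real \<kappa> \<le> (101 + c) * s ^ (1 + k)" by (simp add: algebra_simps)
  have "(real (sample_size B \<epsilon> \<delta>) + 2)\<^sup>2 * (100 + real n + real \<kappa>)
      \<le> (4 * s ^ 5)\<^sup>2 * ((101 + c) * s ^ (1 + k))"
    using T n by (intro mult_mono power_mono) auto
  also have "\<dots> = 16 * (101 + c) * s ^ (11 + k)"
    by (simp add: power_mult_distrib power_mult[symmetric] power_add[symmetric] algebra_simps)
      (simp add: eval_nat_numeral)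
  finally have A: "(real (sample_size B \<epsilon> \<delta>) + 2)\<^sup>2 * (100 + real n + real \<kappa>) \<le> \<dots>" .
  have "20 * real (doublings \<delta>) \<le> 40 * s ^ 1" using j by simp
  also have "\<dots> \<le> 40 * s ^ (11 + k)" by (intro mult_left_mono power_increasing s) auto
  finally show ?thesis using A unfolding s_def[symmetric] by (simp add: algebra_simps)
qed

lemma sample_size_bound:
  assumes \<epsilon>: "0 < \<epsilon>" and \<delta>: "0 < \<delta>" "\<delta> < 1"
  shows "real (sample_size B \<epsilon> \<delta>)
    \<le> 9 * ((max 1 L * M / \<epsilon>) ^ 4 + (B * max 1 L / \<epsilon>) ^ 2) * max 1 (ln (1 / \<delta>))"
proof -
  have "real (sample_size B \<epsilon> \<delta>) \<le> B\<^sup>2 * real (doublings \<delta>) / \<epsilon>\<^sup>2" by (rule sample_size_le[OF \<epsilon>])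
  also have "\<dots> = (B * 1 / \<epsilon>)\<^sup>2 * real (doublings \<delta>)" by (simp add: power_divide)
  also have "\<dots> \<le> (B * max 1 L / \<epsilon>)\<^sup>2 * (9 * max 1 (ln (1 / \<delta>)))"
  proof (intro mult_mono)
    show "(B * 1 / \<epsilon>)\<^sup>2 \<le> (B * max 1 L / \<epsilon>)\<^sup>2"
      unfolding power_divide power_mult_distrib
      by (intro divide_right_mono mult_left_mono power_mono) auto
    \<comment> \<open>Here 1 + 2 ln (1 / \<delta>) is at most 3 times the maximum; 9 is the constant
      shared with the risk bound.\<close>
    show "real (doublings \<delta>) \<le> 9 * max 1 (ln (1 / \<delta>))"
      using doublings(5)[OF \<delta>] by linarith
  qed auto
  also have "\<dots> \<le> ((max 1 L * M / \<epsilon>) ^ 4 + (B * max 1 L / \<epsilon>) ^ 2) * (9 * max 1 (ln (1 / \<delta>)))"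
    by (intro mult_right_mono) auto
  finally show ?thesis by (simp only: mult_ac)
qed

text \<open>With \<eta> = \<epsilon> / j the terms of the average bound are at most 2 \<epsilon>,
  \<epsilon>, 2 \<epsilon> and 4 \<epsilon>, which sum to 9 \<epsilon>. If T = 0, then B^2 j <
  \<epsilon>^2 forces the norm of w below \<epsilon>, so the constant prediction suffices.\<close>

lemma (in sgd) risk_bound:
  assumes \<delta>: "0 < \<delta>" "\<delta> < 1" and B: "sqrt (ip w w) \<le> B" and \<eta>_eq: "\<eta> = rate \<epsilon> \<delta>"
    and T: "T = sample_size B \<epsilon> \<delta>"
  shows "1 - \<delta> \<le> measure (samples {..<T}) {\<omega> \<in> space (samples {..<T}).
    averaged K u \<eta> T \<omega> \<in> borel_measurable S \<and> risk n X D (averaged K u \<eta> T \<omega>) \<le> 9 * L * \<epsilon>}"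
    (is "_ \<le> measure ?P ?G")
proof -
  interpret P: prob_space ?P by (intro prob_space_PiM prob_space_axioms)
  define j where "j = real (doublings \<delta>)"
  have j: "1 \<le> j" "ln (1 / \<delta>) \<le> j" using doublings(3,4)[OF \<delta>] by (auto simp: j_def)
  have w0: "0 \<le> ip w w" by (rule ip_nonneg[OF w_mem])
  then have wB: "ip w w \<le> B\<^sup>2" using B by (simp add: sqrt_le_D)
  have less: "B\<^sup>2 * j < (real T + 1) * \<epsilon>\<^sup>2"
    using less_sample_size_iff[OF \<epsilon>, of T B \<delta>] unfolding T j_def by auto
  have [measurable]: "(\<lambda>\<omega>. risk n X D (averaged K u \<eta> T \<omega>)) \<in> borel_measurable ?P"
    by (rule risk_measurable)
  have G_eq: "?G = {\<omega> \<in> space ?P. risk n X D (averaged K u \<eta> T \<omega>) \<le> 9 * L * \<epsilon>}"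
    using averaged_measurable by auto
  have G: "?G \<in> sets ?P" unfolding G_eq by measurable
  show ?thesis
  proof (cases "T = 0")
    case True
    have "ip w w * 1 \<le> B\<^sup>2 * j" using wB w0 j by (intro mult_mono) auto
    then have "sqrt (ip w w) \<le> \<epsilon>" using less True \<epsilon> by (intro real_le_lsqrt) auto
    then have "L * (\<epsilon> + sqrt (ip w w)) \<le> L * (9 * \<epsilon>)"
      using L_nonneg \<epsilon> by (intro mult_left_mono) auto
    then have "risk n X D (averaged K u \<eta> T \<omega>) \<le> 9 * L * \<epsilon>" for \<omega>
      using risk_constant_le[of \<omega>] True by (simp add: mult_ac)
    then have "?G = space ?P" unfolding G_eq by auto
    then show ?thesis using \<delta> P.prob_space by simp
  next
    case False
    then have T0: "0 < T" "1 \<le> real T" by auto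
    have \<eta>j: "\<eta> = \<epsilon> / j" by (simp add: \<eta>_eq rate_def j_def)
    have "ip w w / (\<eta> * T) \<le> 2 * \<epsilon>"
    proof -
      have "ip w w * j \<le> B\<^sup>2 * j" using wB j by (intro mult_right_mono) auto
      also have "\<dots> \<le> (real T + 1) * \<epsilon>\<^sup>2" using less by simp
      \<comment> \<open>The floor in the sample size costs T + 1 \<le> 2 T, hence the factor
        2.\<close>
      also have "\<dots> \<le> (2 * real T) * \<epsilon>\<^sup>2" using T0 by (intro mult_right_mono) auto
      finally show ?thesis unfolding \<eta>j using T0 \<epsilon> j by (simp add: field_simps power2_eq_square)
    qed
    moreover have "\<eta> \<le> \<epsilon>" unfolding \<eta>j using j \<epsilon> by (simp add: field_simps)
    moreover have "\<eta> * ln (1 / \<delta>) \<le> \<epsilon>"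
    proof -
      have "\<epsilon> * ln (1 / \<delta>) \<le> \<epsilon> * j" using j \<epsilon> by (intro mult_left_mono) auto
      then show ?thesis unfolding \<eta>j using j by (simp add: field_simps)
    qed
    ultimately have le: "ip w w / (\<eta> * T) + \<eta> + 2 * \<epsilon> + 4 * \<eta> * ln (1 / \<delta>) \<le> 9 * \<epsilon>" by linarith
    have "risk n X D (averaged K u \<eta> T \<omega>) \<le> 9 * L * \<epsilon>"
      if "\<omega> \<in> space ?P" "(\<Sum>i<T. surrogate (iter \<omega> i)) / T
          \<le> ip w w / (\<eta> * T) + \<eta> + 2 * \<epsilon> + 4 * \<eta> * ln (1 / \<delta>)" for \<omega>
    proof -
      have "L * ((\<Sum>i<T. surrogate (iter \<omega> i)) / T) \<le> L * (9 * \<epsilon>)"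
        using that(2) le by (intro mult_left_mono L_nonneg) linarith
      then show ?thesis using risk_averaged_le[OF that(1) T0(1)] by (simp add: mult_ac)
    qed
    then have "{\<omega> \<in> space ?P. (\<Sum>i<T. surrogate (iter \<omega> i)) / T
          \<le> ip w w / (\<eta> * T) + \<eta> + 2 * \<epsilon> + 4 * \<eta> * ln (1 / \<delta>)} \<subseteq> ?G"
      unfolding G_eq by auto
    from P.finite_measure_mono[OF this G] surrogate_average_bound[OF T0(1) \<delta>]
    show ?thesis by linarith
  qed
qed

text \<open>The reproducing property identifies the inner product of v and \<psi>(x) with v x. Then
  v is measurable as f minus the measurable residual, and the error moves from the marginal to D by
  change of variables.\<close>

lemma kernel_approximated_sgd:
  assumes X: "X \<subseteq> space (points n)"
    and D: "prob_space D" "sets D = sets (example_space n X)"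
    and u: "L-lipschitz_on UNIV u" "mono u" "range u \<subseteq> {0..1}"
    and f: "f \<in> borel_measurable (domain_space n X)"
    and reg: "AE z in D. cond_mean n X D z = u (f (fst z))"
    and H: "rkhs X K H ip"
    and K: "(\<lambda>(x, x'). K x x') \<in> borel_measurable (domain_space n X \<Otimes>\<^sub>M domain_space n X)"
      "\<forall>x\<in>X. \<forall>x'\<in>X. K x x' \<le> 1"
    and \<epsilon>: "0 < \<epsilon>" and \<eta>: "0 < \<eta>"
    and approx: "kernel_approximated (distr D (domain_space n X) fst) K H ip f \<epsilon> B M"
  obtains w where "sgd X K H ip D n u f w L \<epsilon> M \<eta>" "sqrt (ip w w) \<le> B"
proof -
  interpret H: rkhs X K H ip by (rule H)
  let ?S = "domain_space n X"
  have S: "space ?S = X" by (rule space_domain_space[OF X])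
  note fst [measurable] = fst_measurable_example[OF D(2)]
  obtain v where v: "v \<in> H" "sqrt (ip v v) \<le> B"
    and b: "\<And>x. x \<in> X \<Longrightarrow> \<bar>f x - ip v (feature X K x)\<bar> \<le> M"
    and m [measurable]: "(\<lambda>x. f x - ip v (feature X K x)) \<in> borel_measurable ?S"
    and e: "(\<integral>x. (f x - ip v (feature X K x))\<^sup>2 \<partial>distr D ?S fst) \<le> \<epsilon>\<^sup>2"
    using approx unfolding kernel_approximated_def by (auto simp: S)
  have vx: "ip v (feature X K x) = v x" if "x \<in> X" for x
    by (rule H.reproducing[OF v(1) that])
  have "(\<lambda>x. f x - (f x - ip v (feature X K x))) \<in> borel_measurable ?S"
    by (intro borel_measurable_diff f m)
  then have vm [measurable]: "v \<in> borel_measurable ?S"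
    by (subst measurable_cong[where g = "\<lambda>x. f x - (f x - ip v (feature X K x))"]) (auto simp: S vx)
  have "(\<integral>z. (f (fst z) - v (fst z))\<^sup>2 \<partial>D) = (\<integral>z. (f (fst z) - ip v (feature X K (fst z)))\<^sup>2 \<partial>D)"
    using measurable_space[OF fst] by (intro Bochner_Integration.integral_cong) (auto simp: S vx)
  also have "\<dots> = (\<integral>x. (f x - ip v (feature X K x))\<^sup>2 \<partial>distr D ?S fst)"
    by (rule integral_distr[symmetric]) measurable
  finally have err: "(\<integral>z. (f (fst z) - v (fst z))\<^sup>2 \<partial>D) \<le> \<epsilon>\<^sup>2" using e by simp
  have "sgd X K H ip D n u f v L \<epsilon> M \<eta>"
    by (intro sgd.intro H D(1) sgd_axioms.intro) (use assms b v vm err vx in auto)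
  then show ?thesis using that v(2) by blast
qed

theorem theorem2:
  shows "\<exists>(C::real) (train::com) (predict::com). 0 < C \<and>
    (\<forall>kc::nat \<Rightarrow> nat. poly_bounded kc \<longrightarrow>
      (\<exists>(a::real) (k::nat).
        \<forall>(n::nat) (X::point set) (D::example measure) (u::real \<Rightarrow> real) (f::point \<Rightarrow> real)
         (K::point \<Rightarrow> point \<Rightarrow> real) (H::(point \<Rightarrow> real) set) ip
         (L::real) (\<epsilon>::real) (B::real) (M::real) (\<delta>::real).
          X \<subseteq> space (points n) \<longrightarrow>
          prob_space D \<longrightarrow> sets D = sets (example_space n X) \<longrightarrow>
          L-lipschitz_on UNIV u \<longrightarrow> mono u \<longrightarrow> range u \<subseteq> {0..1} \<longrightarrow>
          f \<in> borel_measurable (domain_space n X) \<longrightarrow>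
          (AE z in D. cond_mean n X D z = u (f (fst z))) \<longrightarrow>
          rkhs X K H ip \<longrightarrow>
          (\<lambda>(x, x'). K x x') \<in> borel_measurable (domain_space n X \<Otimes>\<^sub>M domain_space n X) \<longrightarrow>
          (\<forall>x\<in>X. \<forall>x'\<in>X. K x x' \<le> 1) \<longrightarrow>
          0 < \<epsilon> \<longrightarrow>
          kernel_approximated (distr D (domain_space n X) fst) K H ip f \<epsilon> B M \<longrightarrow>
          0 < \<delta> \<longrightarrow> \<delta> < 1 \<longrightarrow>
          (\<exists>(m::nat) (h::(nat \<Rightarrow> example) \<Rightarrow> point \<Rightarrow> real).
            real m \<le> C * ((max 1 L * M / \<epsilon>) ^ 4 + (B * max 1 L / \<epsilon>) ^ 2) * max 1 (ln (1 / \<delta>)) \<and>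
            (\<forall>\<omega> \<in> space (Pi\<^sub>M {..<m} (\<lambda>_. D)).
              outputs_hypothesis train predict
                \<lparr>dimension = n, kernel = K, kernel_cost = kc n, link = u, examples = \<omega>\<rparr>
                [B, M, L, \<epsilon>, \<delta>] X m
                (a * (1 + real n + B + M + L + 1 / \<epsilon> + ln (1 / \<delta>)) ^ k) (h \<omega>)) \<and>
            measure (Pi\<^sub>M {..<m} (\<lambda>_. D))
              {\<omega> \<in> space (Pi\<^sub>M {..<m} (\<lambda>_. D)).
                h \<omega> \<in> borel_measurable (domain_space n X) \<and> risk n X D (h \<omega>) \<le> C * L * \<epsilon>}
              \<ge> 1 - \<delta>)))"
proof (rule exI[of _ 9], rule exI[of _ train_prog], rule exI[of _ predict_prog], intro conjI allI impI)
  fix kc :: "nat \<Rightarrow> nat" assume "poly_bounded kc"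
  then obtain c k where c: "0 \<le> c" "\<And>n. real (kc n) \<le> c * (1 + real n) ^ k"
    by (rule poly_boundedE) blast
  show "\<exists>(a::real) (k::nat).
        \<forall>(n::nat) (X::point set) (D::example measure) (u::real \<Rightarrow> real) (f::point \<Rightarrow> real)
         (K::point \<Rightarrow> point \<Rightarrow> real) (H::(point \<Rightarrow> real) set) ip
         (L::real) (\<epsilon>::real) (B::real) (M::real) (\<delta>::real).
          X \<subseteq> space (points n) \<longrightarrow>
          prob_space D \<longrightarrow> sets D = sets (example_space n X) \<longrightarrow>
          L-lipschitz_on UNIV u \<longrightarrow> mono u \<longrightarrow> range u \<subseteq> {0..1} \<longrightarrow>
          f \<in> borel_measurable (domain_space n X) \<longrightarrow>
          (AE z in D. cond_mean n X D z = u (f (fst z))) \<longrightarrow>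
          rkhs X K H ip \<longrightarrow>
          (\<lambda>(x, x'). K x x') \<in> borel_measurable (domain_space n X \<Otimes>\<^sub>M domain_space n X) \<longrightarrow>
          (\<forall>x\<in>X. \<forall>x'\<in>X. K x x' \<le> 1) \<longrightarrow>
          0 < \<epsilon> \<longrightarrow>
          kernel_approximated (distr D (domain_space n X) fst) K H ip f \<epsilon> B M \<longrightarrow>
          0 < \<delta> \<longrightarrow> \<delta> < 1 \<longrightarrow>
          (\<exists>(m::nat) (h::(nat \<Rightarrow> example) \<Rightarrow> point \<Rightarrow> real).
            real m \<le> 9 * ((max 1 L * M / \<epsilon>) ^ 4 + (B * max 1 L / \<epsilon>) ^ 2) * max 1 (ln (1 / \<delta>)) \<and>
            (\<forall>\<omega> \<in> space (Pi\<^sub>M {..<m} (\<lambda>_. D)).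
              outputs_hypothesis train_prog predict_prog
                \<lparr>dimension = n, kernel = K, kernel_cost = kc n, link = u, examples = \<omega>\<rparr>
                [B, M, L, \<epsilon>, \<delta>] X m
                (a * (1 + real n + B + M + L + 1 / \<epsilon> + ln (1 / \<delta>)) ^ k) (h \<omega>)) \<and>
            measure (Pi\<^sub>M {..<m} (\<lambda>_. D))
              {\<omega> \<in> space (Pi\<^sub>M {..<m} (\<lambda>_. D)).
                h \<omega> \<in> borel_measurable (domain_space n X) \<and> risk n X D (h \<omega>) \<le> 9 * L * \<epsilon>}
              \<ge> 1 - \<delta>)"
  proof (rule exI[of _ "1656 + 16 * c"], rule exI[of _ "11 + k"], intro allI impI, goal_cases)
    case (1 n X D u f K H ip L \<epsilon> B M \<delta>)
    note \<epsilon> = 1(12) and \<delta> = 1(14,15)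
    define T where "T = sample_size B \<epsilon> \<delta>"
    define \<eta> where "\<eta> = rate \<epsilon> \<delta>"
    have "0 < \<eta>" unfolding \<eta>_def rate_def using \<epsilon> doublings(3)[OF \<delta>] by simp
    then obtain w where "sgd X K H ip D n u f w L \<epsilon> M \<eta>" and B: "sqrt (ip w w) \<le> B"
      using kernel_approximated_sgd[OF 1(1-12) _ 1(13)] by blast
    then interpret sgd X K H ip D n u f w L \<epsilon> M \<eta> by simp
    obtain z where z: "z \<in> space D" using not_empty by blast
    \<comment> \<open>A probability space is nonempty, so the uniform bound at a single point forces
      M \<ge> 0. The time bound needs B, M and L nonnegative.\<close>
    have M: "0 \<le> M" using w_bound[of "fst z"] z space_D by fastforce
    have B0: "0 \<le> B" using B ip_nonneg[OF w_mem] by (meson order_trans real_sqrt_ge_zero)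
    have X_ext: "X \<subseteq> extensional {..<n}" using X by (auto simp: points_def space_PiM PiE_def)
    show ?case
    proof (intro exI[of _ T] exI[of _ "averaged K u \<eta> T"] conjI ballI)
      show "real T \<le> 9 * ((max 1 L * M / \<epsilon>) ^ 4 + (B * max 1 L / \<epsilon>) ^ 2) * max 1 (ln (1 / \<delta>))"
        unfolding T_def by (rule sample_size_bound[OF \<epsilon> \<delta>])
      show "outputs_hypothesis train_prog predict_prog
          \<lparr>dimension = n, kernel = K, kernel_cost = kc n, link = u, examples = \<omega>\<rparr>
          [B, M, L, \<epsilon>, \<delta>] X T
          ((1656 + 16 * c) * (1 + real n + B + M + L + 1 / \<epsilon> + ln (1 / \<delta>)) ^ (11 + k))
          (averaged K u \<eta> T \<omega>)" if "\<omega> \<in> space (samples {..<T})" for \<omega>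
        unfolding T_def \<eta>_def
        by (rule outputs_averaged[OF refl \<epsilon> \<delta> X_ext sample_mem[OF that]
              training_time_le[OF \<epsilon> \<delta> B0 M L_nonneg c(2,1)]]) (simp add: T_def)
      show "1 - \<delta> \<le> measure (samples {..<T}) {\<omega> \<in> space (samples {..<T}).
          averaged K u \<eta> T \<omega> \<in> borel_measurable S \<and> risk n X D (averaged K u \<eta> T \<omega>) \<le> 9 * L * \<epsilon>}"
        by (rule risk_bound[OF \<delta> B \<eta>_def T_def])
    qed
  qed
qed simp

end
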